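(* Let $\Phi=\{\varphi_i\}_{i=1}^\infty$ and $\Psi=\{\psi_i\}_{i=1}^\infty$ be Riesz bases for a Hilbert space $\mathbb{H}$. For $\sigma\subset\mathbb{N}$ put $D_\sigma=d\big(\overline{\mathrm{span}}\{\varphi_i\}_{i\in\sigma},\ \overline{\mathrm{span}}\{\psi_i\}_{i\in\sigma^c}\big)$. The following are equivalent: (i) $\Phi$ and $\Psi$ are woven; (ii) for every $\sigma\subset\mathbb{N}$, $D_\sigma>0$; (iii) there is a constant $C>0$ such that for every $\sigma\subset\mathbb{N}$, $D_\sigma\ge C$.
   Context: A family $\{f_i\}_{i\in I}$ in $\mathbb{H}$ is a frame for $\mathbb H$ with lower and upper frame bounds $A,B$ if $0<A\le B<\infty$ and $A\|x\|^2\le \sum_{i\in I}|\langle x,f_i\rangle|^2\le B\|x\|^2$ for all $x\in\mathbb{H}$. It is a Riesz sequence with Riesz bounds $A,B$ if $0<A\le B<\infty$ and $A\sum_{i}|c_i|^2\le\|\sum_{i}c_if_i\|^2\le B\sum_{i}|c_i|^2$ for all $\{c_i\}\in\ell^2(I)$; it is a Riesz basis for $\mathbb{H}$ if in addition its closed span is $\mathbb{H}$. Two frames $\{\varphi_i\}_{i=1}^\infty$, $\{\psi_i\}_{i=1}^\infty$ for $\mathbb{H}$ are woven if there are universal constants $0<A\le B<\infty$ such that for every $\sigma\subset\mathbb{N}$ (with $\sigma^c=\mathbb N\setminus\sigma$) the indexed family $\{\varphi_i\}_{i\in\sigma}\cup\{\psi_i\}_{i\in\sigma^c}$ is a frame for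 $\mathbb{H}$ with lower and upper frame bounds $A$ and $B$. For subspaces $W_1,W_2$ of $\mathbb{H}$, let $S_{W_i}$ be the set of unit vectors in $W_i$, $d_{W_1}(W_2)=\inf\{\|x-y\|: x\in W_1,\ y\in S_{W_2}\}$, $d_{W_2}(W_1)=\inf\{\|x-y\|: x\in S_{W_1},\ y\in W_2\}$, and $d(W_1,W_2)=\min\{d_{W_1}(W_2),d_{W_2}(W_1)\}$, where the infimum of the empty set is $+\infty$. *)

theory Defs
  imports "HOL-Analysis.Analysis"
begin

(* Hilbert spaces here may be real or complex. The class below captures the two scalar fields at
   once: the axioms make every element a root of a real quadratic polynomial, so that up to
   isomorphism only the real and the complex numbers satisfy them, with cj the usual conjugation. *)

class rc_field = real_normed_field +
  fixes cj :: "'a \<Rightarrow> 'a"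
  assumes cj_add: "cj (x + y) = cj x + cj y"
    and cj_mult: "cj (x * y) = cj x * cj y"
    and mult_cj: "x * cj x = ((norm x)\<^sup>2) *\<^sub>R 1"

instantiation real :: rc_field
begin

definition cj_real :: "real \<Rightarrow> real" where
  "cj_real x = x"

instance
  by standard (auto simp: cj_real_def power2_eq_square)

end

instantiation complex :: rc_field
begin

definition cj_complex :: "complex \<Rightarrow> complex" where
  "cj_complex = cnj"

instance
proof
  fix x y :: complex
  show "x * cj x = ((norm x)\<^sup>2) *\<^sub>R 1"
    by (simp only: cj_complex_def scaleR_conv_of_real mult_1_right complex_norm_square)
qed (simp_all add: cj_complex_def)

end

(* The carrier is the whole type, and completeness is its sort banach. The norm of the type is
   required to be the one of the inner product, so closures, sums and limits are the library's. The
   inner product is linear in the first argument. *)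

locale hilbert_space = vector_space smul
  for smul :: "'k::rc_field \<Rightarrow> 'h::banach \<Rightarrow> 'h" +
  fixes ip :: "'h \<Rightarrow> 'h \<Rightarrow> 'k"
  assumes scale_of_real: "smul (of_real r) x = r *\<^sub>R x"
    and ip_add_left: "ip (x + y) z = ip x z + ip y z"
    and ip_scale_left: "ip (smul a x) z = a * ip x z"
    and ip_commute: "ip y x = cj (ip x y)"
    and ip_self: "ip x x = of_real ((norm x)\<^sup>2)"

lemma hilbert_space_real:
  "hilbert_space (scaleR :: real \<Rightarrow> 'a \<Rightarrow> 'a::{real_inner, banach}) inner"
  by unfold_locales
    (simp_all add: cj_real_def inner_add_left inner_add_right power2_norm_eq_inner inner_commute)

lemma hilbert_space_complex: "hilbert_space ((*) :: complex \<Rightarrow> _) (\<lambda>x y. x * cnj y)"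
proof unfold_locales
  show "x * cnj x = of_real ((norm x)\<^sup>2)" for x :: complex
    by (rule complex_norm_square[symmetric])
qed (simp_all add: cj_complex_def algebra_simps scaleR_conv_of_real)

definition closed_span :: "('k::rc_field \<Rightarrow> 'h::banach \<Rightarrow> 'h) \<Rightarrow> 'h set \<Rightarrow> 'h set" where
  "closed_span smul S = closure (module.span smul S)"

(* The default value 0 of infsum for divergent sums must not satisfy an upper bound, hence the
   explicit summability conditions here and in riesz_bounds. *)

definition frame_bounds ::
    "('h::banach \<Rightarrow> 'h \<Rightarrow> 'k::rc_field) \<Rightarrow> 'i set \<Rightarrow> ('i \<Rightarrow> 'h) \<Rightarrow> real \<Rightarrow> real \<Rightarrow> bool" where
  "frame_bounds ip I f A B \<longleftrightarrow> 0 < A \<and> A \<le> B \<and>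
     (\<forall>x. (\<lambda>i. (norm (ip x (f i)))\<^sup>2) summable_on I \<and>
          A * (norm x)\<^sup>2 \<le> (\<Sum>\<^sub>\<infinity>i\<in>I. (norm (ip x (f i)))\<^sup>2) \<and>
          (\<Sum>\<^sub>\<infinity>i\<in>I. (norm (ip x (f i)))\<^sup>2) \<le> B * (norm x)\<^sup>2)"

definition is_frame ::
    "('h::banach \<Rightarrow> 'h \<Rightarrow> 'k::rc_field) \<Rightarrow> 'i set \<Rightarrow> ('i \<Rightarrow> 'h) \<Rightarrow> bool" where
  "is_frame ip I f \<longleftrightarrow> (\<exists>A B. frame_bounds ip I f A B)"

definition riesz_bounds ::
    "('k::rc_field \<Rightarrow> 'h::banach \<Rightarrow> 'h) \<Rightarrow> 'i set \<Rightarrow> ('i \<Rightarrow> 'h) \<Rightarrow> real \<Rightarrow> real \<Rightarrow> bool" where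
  "riesz_bounds smul I f A B \<longleftrightarrow> 0 < A \<and> A \<le> B \<and>
     (\<forall>c :: 'i \<Rightarrow> 'k. (\<lambda>i. (norm (c i))\<^sup>2) summable_on I \<longrightarrow>
        (\<lambda>i. smul (c i) (f i)) summable_on I \<and>
        A * (\<Sum>\<^sub>\<infinity>i\<in>I. (norm (c i))\<^sup>2) \<le> (norm (\<Sum>\<^sub>\<infinity>i\<in>I. smul (c i) (f i)))\<^sup>2 \<and>
        (norm (\<Sum>\<^sub>\<infinity>i\<in>I. smul (c i) (f i)))\<^sup>2 \<le> B * (\<Sum>\<^sub>\<infinity>i\<in>I. (norm (c i))\<^sup>2))"

definition riesz_sequence ::
    "('k::rc_field \<Rightarrow> 'h::banach \<Rightarrow> 'h) \<Rightarrow> 'i set \<Rightarrow> ('i \<Rightarrow> 'h) \<Rightarrow> bool" where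
  "riesz_sequence smul I f \<longleftrightarrow> (\<exists>A B. riesz_bounds smul I f A B)"

definition riesz_basis ::
    "('k::rc_field \<Rightarrow> 'h::banach \<Rightarrow> 'h) \<Rightarrow> 'i set \<Rightarrow> ('i \<Rightarrow> 'h) \<Rightarrow> bool" where
  "riesz_basis smul I f \<longleftrightarrow> riesz_sequence smul I f \<and> closed_span smul (f ` I) = UNIV"

definition weaving :: "nat set \<Rightarrow> (nat \<Rightarrow> 'h) \<Rightarrow> (nat \<Rightarrow> 'h) \<Rightarrow> nat \<Rightarrow> 'h" where
  "weaving \<sigma> \<phi> \<psi> i = (if i \<in> \<sigma> then \<phi> i else \<psi> i)"

definition woven ::
    "('h::banach \<Rightarrow> 'h \<Rightarrow> 'k::rc_field) \<Rightarrow> (nat \<Rightarrow> 'h) \<Rightarrow> (nat \<Rightarrow> 'h) \<Rightarrow> bool" where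
  "woven ip \<phi> \<psi> \<longleftrightarrow> is_frame ip UNIV \<phi> \<and> is_frame ip UNIV \<psi> \<and>
     (\<exists>A B. 0 < A \<and> A \<le> B \<and> (\<forall>\<sigma>. frame_bounds ip UNIV (weaving \<sigma> \<phi> \<psi>) A B))"

definition unit_vectors :: "'h::real_normed_vector set \<Rightarrow> 'h set" where
  "unit_vectors W = {x \<in> W. norm x = 1}"

(* Values are extended reals so that the infimum over the empty set, which occurs when one of the
   subspaces is {0}, is infinity. *)

definition gap_left :: "'h::real_normed_vector set \<Rightarrow> 'h set \<Rightarrow> ereal" where
  "gap_left W\<^sub>1 W\<^sub>2 = Inf {ereal (norm (x - y)) | x y. x \<in> W\<^sub>1 \<and> y \<in> unit_vectors W\<^sub>2}"

definition gap_right :: "'h::real_normed_vector set \<Rightarrow> 'h set \<Rightarrow> ereal" where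
  "gap_right W\<^sub>1 W\<^sub>2 = Inf {ereal (norm (x - y)) | x y. x \<in> unit_vectors W\<^sub>1 \<and> y \<in> W\<^sub>2}"

definition subspace_dist :: "'h::real_normed_vector set \<Rightarrow> 'h set \<Rightarrow> ereal" where
  "subspace_dist W\<^sub>1 W\<^sub>2 = min (gap_left W\<^sub>1 W\<^sub>2) (gap_right W\<^sub>1 W\<^sub>2)"

definition weaving_dist ::
    "('k::rc_field \<Rightarrow> 'h::banach \<Rightarrow> 'h) \<Rightarrow> (nat \<Rightarrow> 'h) \<Rightarrow> (nat \<Rightarrow> 'h) \<Rightarrow> nat set \<Rightarrow> ereal" where
  "weaving_dist smul \<phi> \<psi> \<sigma> =
     subspace_dist (closed_span smul (\<phi> ` \<sigma>)) (closed_span smul (\<psi> ` (- \<sigma>)))"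

end

theory Submission
  imports Defs
begin

text \<open>
  Write \<open>W \<sigma>\<close> for the synthesis map \<open>c \<mapsto> \<Sum>i. c\<^sub>i w\<^sub>i\<close> on square-summable sequences, where \<open>w\<close> is
  the weaving that takes \<open>\<phi> i\<close> for \<open>i \<in> \<sigma>\<close> and \<open>\<psi> i\<close> otherwise. The distance \<open>D \<sigma>\<close> measures how
  far \<open>W \<sigma>\<close> is from losing norm: splitting \<open>W \<sigma> c\<close> into its \<open>\<phi>\<close>-part and its \<open>\<psi>\<close>-part shows that
  \<open>D \<sigma>\<close> is at least a positive constant if and only if \<open>W \<sigma>\<close> is bounded below, each
  constant controlling the other independently of \<open>\<sigma>\<close> (\<open>bounded_below_weaving_dist\<close>,
  \<open>weaving_dist_bounded_below\<close>). The lower frame bound of a weaving says the same about the adjoint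
  of \<open>W \<sigma>\<close>, so wovenness is a statement about uniform surjectivity and the distances are about
  uniform injectivity.

  These two meet on cofinite \<open>\<sigma>\<close>. There \<open>W \<sigma>\<close> differs from the isomorphism \<open>W UNIV\<close> by an operator of
  finite rank, so it is injective if and only if it is surjective; the proof changes one
  vector at a time (\<open>change_one_onto\<close>, \<open>change_one_injective\<close>). When \<open>W \<sigma>\<close> is bijective, the
  lower bounds of \<open>W \<sigma>\<close> and of its adjoint coincide. Every \<open>\<sigma>\<close> is the limit of the cofinite sets
  \<open>\<sigma> \<union> {n..}\<close>, and both kinds of lower bound pass to strong limits. Hence woven means
  that all \<open>W \<sigma>\<close> are bounded below by one constant (\<open>woven_iff_uniformly_bounded_below\<close>).

  It remains to make a pointwise bound uniform (\<open>uniformly_bounded_below\<close>). A category argument on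
  the Cantor space of all \<open>\<sigma>\<close> gives one cylinder with a uniform bound, because otherwise a limit of
  nested cylinders would violate its own bound (\<open>some_locally_bounded_below\<close>). A uniform bound on
  a neighbourhood of \<open>\<sigma>\<close> survives the change of one element of \<open>\<sigma>\<close>
  (\<open>locally_bounded_below_flip\<close>): this is where injectivity of the new \<open>W\<close> and surjectivity of the old one
  enter. Since every set is a finite change of a set in the good cylinder, every \<open>\<sigma>\<close> has a
  neighbourhood with a uniform bound, and compactness of the Cantor space concludes
  (\<open>uniform_if_locally_bounded_below\<close>).
\<close>

section \<open>Scalars and the inner product\<close>

lemma cj_zero: "cj (0::'k::rc_field) = 0"
  using cj_add[of "0::'k" 0] by simp

lemma cj_of_real: "cj (of_real r :: 'k::rc_field) = of_real r"
proof (cases "r = 0")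
  case False
  have "of_real r * cj (of_real r :: 'k) = of_real r * of_real r"
    by (simp add: mult_cj power2_eq_square scaleR_conv_of_real)
  with False show ?thesis by simp
qed (simp add: cj_zero)

lemma norm_cj: "norm (cj x) = norm (x::'k::rc_field)"
proof (cases "x = 0")
  case False
  have "norm x * norm (cj x) = norm x * norm x"
    by (metis mult_cj norm_mult norm_scaleR norm_one mult_1_right abs_power2 power2_eq_square
        real_norm_def norm_power)
  with False show ?thesis by simp
qed (simp add: cj_zero)

lemma cj_minus: "cj (- x) = - cj (x::'k::rc_field)"
  by (metis add.left_inverse cj_add cj_zero eq_neg_iff_add_eq_0)

context hilbert_space
begin

lemma ip_zero_left [simp]: "ip 0 y = 0"
  using ip_add_left[of 0 0 y] by simp

lemma ip_minus_left: "ip (- x) y = - ip x y"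
  by (metis add.right_inverse eq_neg_iff_add_eq_0 add.commute ip_add_left ip_zero_left)

lemma ip_diff_left: "ip (x - y) z = ip x z - ip y z"
  by (metis diff_conv_add_uminus ip_add_left ip_minus_left)

lemma ip_add_right: "ip z (x + y) = ip z x + ip z y"
  by (metis ip_commute ip_add_left cj_add)

lemma ip_scale_right: "ip z (smul a x) = cj a * ip z x"
  by (metis ip_commute ip_scale_left cj_mult)

lemma ip_diff_right: "ip z (x - y) = ip z x - ip z y"
  by (metis ip_commute ip_diff_left diff_conv_add_uminus cj_add cj_minus)

lemma ip_zero_right [simp]: "ip x 0 = 0"
  using ip_add_right[of x 0 0] by simp

lemma ip_sum_right: "ip x (\<Sum>i\<in>F. f i) = (\<Sum>i\<in>F. ip x (f i))"
  by (induction F rule: infinite_finite_induct) (auto simp: ip_add_right)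

lemma ip_scaleR_left: "ip (r *\<^sub>R x) y = r *\<^sub>R ip x y"
  by (metis ip_scale_left scale_of_real scaleR_conv_of_real)

lemma ip_scaleR_right: "ip x (r *\<^sub>R y) = r *\<^sub>R ip x y"
  by (metis ip_scale_right scale_of_real scaleR_conv_of_real cj_of_real)

lemma norm_smul: "norm (smul a x) = norm a * norm x"
proof -
  have "ip (smul a x) (smul a x) = a * cj a * ip x x"
    by (simp add: ip_scale_left ip_scale_right ac_simps)
  also have "\<dots> = of_real ((norm a * norm x)\<^sup>2)"
    by (simp add: mult_cj ip_self scaleR_conv_of_real power_mult_distrib)
  finally have "of_real ((norm (smul a x))\<^sup>2) = (of_real ((norm a * norm x)\<^sup>2) :: 'k)"
    by (simp only: ip_self)
  then have "(norm (smul a x))\<^sup>2 = (norm a * norm x)\<^sup>2"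
    unfolding of_real_eq_iff .
  then show ?thesis
    by (simp add: power2_eq_iff_nonneg)
qed

lemma ip_Cauchy_Schwarz: "norm (ip x y) \<le> norm x * norm y"
proof (cases "y = 0")
  case False
  define a where "a = ip x y / of_real ((norm y)\<^sup>2)"
  define z where "z = x - smul a y"
  have "ip z y = 0"
    using False by (simp add: z_def ip_diff_left ip_scale_left ip_self a_def)
  then have "ip z z = ip z x"
    using z_def by (metis ip_diff_right ip_scale_right mult_zero_right diff_zero)
  also have "\<dots> = ip x x - a * cj (ip x y)"
    by (metis z_def ip_diff_left ip_scale_left ip_commute)
  also have "a * cj (ip x y) = (ip x y * cj (ip x y)) / of_real ((norm y)\<^sup>2)"
    by (simp add: a_def)
  also have "\<dots> = of_real ((norm (ip x y))\<^sup>2 / (norm y)\<^sup>2)"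
    by (simp add: mult_cj scaleR_conv_of_real)
  finally have "of_real ((norm z)\<^sup>2) = (of_real ((norm x)\<^sup>2 - (norm (ip x y))\<^sup>2 / (norm y)\<^sup>2) :: 'k)"
    by (simp only: ip_self of_real_diff)
  then have "(norm z)\<^sup>2 = (norm x)\<^sup>2 - (norm (ip x y))\<^sup>2 / (norm y)\<^sup>2"
    unfolding of_real_eq_iff .
  then have "(norm (ip x y))\<^sup>2 / (norm y)\<^sup>2 \<le> (norm x)\<^sup>2"
    using zero_le_power2[of "norm z"] by linarith
  then have "(norm (ip x y))\<^sup>2 \<le> (norm x * norm y)\<^sup>2"
    using False by (simp add: field_simps power_mult_distrib)
  then show ?thesis
    by (rule power2_le_imp_le) simp
qed simp

lemma bounded_linear_ip_left: "bounded_linear (\<lambda>x. ip x y)"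
  by (rule bounded_linear_intro[where K = "norm y"])
    (auto simp: ip_add_left ip_scaleR_left ip_Cauchy_Schwarz)

lemma bounded_linear_ip_right: "bounded_linear (\<lambda>y. ip x y)"
  by (rule bounded_linear_intro[where K = "norm x"])
    (simp_all add: ip_add_right ip_scaleR_right ip_Cauchy_Schwarz mult.commute[of _ "norm x"])

lemma bounded_linear_smul: "bounded_linear (smul a)"
proof (rule bounded_linear_intro[where K = "norm a"])
  show "smul a (r *\<^sub>R x) = r *\<^sub>R smul a x" for r x
    by (metis scale_of_real scale_left_commute)
qed (auto simp: scale_right_distrib norm_smul mult.commute)

text \<open>Completeness of the scalar field is inherited from the space: the field embeds along any nonzero
  \<open>h\<close>, and the inner product with \<open>h\<close> reads the limit off again.\<close>

lemma convergent_scalars: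
  fixes a :: "nat \<Rightarrow> 'k" and h :: 'h
  assumes "h \<noteq> 0" "Cauchy a"
  shows "convergent a"
proof -
  have "Cauchy (\<lambda>n. smul (a n) h)"
  proof (rule CauchyI)
    fix e :: real assume "e > 0"
    with assms(1) have "e / norm h > 0" by simp
    from CauchyD[OF assms(2) this] obtain M
      where M: "\<And>m n. m \<ge> M \<Longrightarrow> n \<ge> M \<Longrightarrow> norm (a m - a n) < e / norm h" by blast
    have "norm (smul (a m) h - smul (a n) h) < e" if "m \<ge> M" "n \<ge> M" for m n
      using M[OF that] assms(1)
      by (simp add: scale_left_diff_distrib[symmetric] norm_smul pos_less_divide_eq)
    then show "\<exists>M. \<forall>m\<ge>M. \<forall>n\<ge>M. norm (smul (a m) h - smul (a n) h) < e" by blast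
  qed
  then obtain z where "(\<lambda>n. smul (a n) h) \<longlonglongrightarrow> z"
    by (meson Cauchy_convergent convergent_def)
  then have "(\<lambda>n. ip (smul (a n) h) h / of_real ((norm h)\<^sup>2))
      \<longlonglongrightarrow> ip z h / of_real ((norm h)\<^sup>2)"
    by (intro tendsto_divide tendsto_const bounded_linear.tendsto[OF bounded_linear_ip_left])
      (use assms(1) in simp_all)
  moreover have "ip (smul (a n) h) h / of_real ((norm h)\<^sup>2) = a n" for n
    using assms(1) by (simp add: ip_scale_left ip_self)
  ultimately show ?thesis
    by (auto simp: convergent_def)
qed

end

section \<open>Square-summable coefficients\<close>

definition ell2 :: "('i \<Rightarrow> 'k::real_normed_vector) \<Rightarrow> bool" where
  "ell2 c \<longleftrightarrow> (\<lambda>i. (norm (c i))\<^sup>2) summable_on UNIV"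

definition l2norm :: "('i \<Rightarrow> 'k::real_normed_vector) \<Rightarrow> real" where
  "l2norm c = sqrt (\<Sum>\<^sub>\<infinity>i. (norm (c i))\<^sup>2)"

lemma l2norm_nonneg [simp]: "0 \<le> l2norm c"
  by (simp add: l2norm_def infsum_nonneg)

lemma l2norm_square: "(l2norm c)\<^sup>2 = (\<Sum>\<^sub>\<infinity>i. (norm (c i))\<^sup>2)"
  by (simp add: l2norm_def infsum_nonneg)

lemma sum_le_l2norm: "ell2 c \<Longrightarrow> finite F \<Longrightarrow> (\<Sum>i\<in>F. (norm (c i))\<^sup>2) \<le> (l2norm c)\<^sup>2"
  unfolding l2norm_square ell2_def by (rule finite_sum_le_infsum) auto

lemma L2_set_le_l2norm:
  assumes "ell2 c" "finite F"
  shows "L2_set (\<lambda>i. norm (c i)) F \<le> l2norm c"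
  unfolding L2_set_def using sum_le_l2norm[OF assms] by (simp add: real_le_lsqrt sum_nonneg)

text \<open>Finite partial norms suffice, which reduces the triangle inequality and completeness to the
  finite-dimensional \<open>L2_set\<close>.\<close>

lemma ell2_bounded:
  assumes "\<And>F. finite F \<Longrightarrow> L2_set (\<lambda>i. norm (c i)) F \<le> b"
  shows "ell2 c" "l2norm c \<le> b"
proof -
  have b: "0 \<le> b" using assms[of "{}"] by simp
  have F: "(\<Sum>i\<in>F. (norm (c i))\<^sup>2) \<le> b\<^sup>2" if "finite F" for F
    using assms[OF that] unfolding L2_set_def by (rule sqrt_le_D)
  show *: "ell2 c"
    unfolding ell2_def by (rule nonneg_bdd_above_summable_on) (auto intro!: bdd_aboveI2 F)
  have "(l2norm c)\<^sup>2 \<le> b\<^sup>2"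
    unfolding l2norm_square by (rule infsum_le_finite_sums) (use * F in \<open>auto simp: ell2_def\<close>)
  then show "l2norm c \<le> b" using b by (rule power2_le_imp_le)
qed

lemma ell2_mono:
  assumes "ell2 d" "\<And>i. norm (c i) \<le> norm (d i)"
  shows "ell2 c" "l2norm c \<le> l2norm d"
proof -
  have "L2_set (\<lambda>i. norm (c i)) F \<le> l2norm d" if "finite F" for F
    by (rule order_trans[OF L2_set_mono L2_set_le_l2norm]) (use assms that in auto)
  from ell2_bounded[OF this] show "ell2 c" "l2norm c \<le> l2norm d" by blast+
qed

lemma ell2_add:
  assumes "ell2 c" "ell2 d"
  shows "ell2 (\<lambda>i. c i + d i)" "l2norm (\<lambda>i. c i + d i) \<le> l2norm c + l2norm d"
proof -
  have "L2_set (\<lambda>i. norm (c i + d i)) F \<le> l2norm c + l2norm d" if "finite F" for F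
  proof -
    have "L2_set (\<lambda>i. norm (c i + d i)) F \<le> L2_set (\<lambda>i. norm (c i) + norm (d i)) F"
      by (rule L2_set_mono) (auto simp: norm_triangle_ineq)
    also have "\<dots> \<le> L2_set (\<lambda>i. norm (c i)) F + L2_set (\<lambda>i. norm (d i)) F"
      by (rule L2_set_triangle_ineq)
    also have "\<dots> \<le> l2norm c + l2norm d"
      using assms that by (intro add_mono L2_set_le_l2norm)
    finally show ?thesis .
  qed
  from ell2_bounded[OF this]
  show "ell2 (\<lambda>i. c i + d i)" "l2norm (\<lambda>i. c i + d i) \<le> l2norm c + l2norm d" by blast+
qed

lemma ell2_scale:
  fixes c :: "'i \<Rightarrow> 'k::real_normed_field"
  assumes "ell2 c"
  shows "ell2 (\<lambda>i. a * c i)" "l2norm (\<lambda>i. a * c i) = norm a * l2norm c"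
  using assms unfolding ell2_def l2norm_def
  by (auto simp: norm_mult power_mult_distrib summable_on_cmult_right infsum_cmult_right'
      real_sqrt_mult)

lemma ell2_diff:
  assumes "ell2 c" "ell2 d"
  shows "ell2 (\<lambda>i. c i - d i)"
  using ell2_add(1)[OF assms(1) ell2_mono(1)[OF assms(2), of "\<lambda>i. - d i"]] by simp

lemma norm_le_l2norm: "ell2 c \<Longrightarrow> norm (c i) \<le> l2norm c"
  using L2_set_le_l2norm[of c "{i}"] by simp

lemma ell2_finite_support:
  assumes "finite F" "\<And>i. i \<notin> F \<Longrightarrow> c i = 0"
  shows "ell2 c" "(l2norm c)\<^sup>2 = (\<Sum>i\<in>F. (norm (c i))\<^sup>2)"
proof -
  have "((\<lambda>i. (norm (c i))\<^sup>2) has_sum (\<Sum>i\<in>F. (norm (c i))\<^sup>2)) UNIV"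
    by (rule has_sum_finite_neutralI) (use assms in auto)
  then show "ell2 c" "(l2norm c)\<^sup>2 = (\<Sum>i\<in>F. (norm (c i))\<^sup>2)"
    unfolding ell2_def l2norm_square by (auto simp: has_sum_imp_summable infsumI)
qed

lemma ell2_zero [simp]: "ell2 (\<lambda>_. 0)" "l2norm (\<lambda>_. 0) = 0"
  by (simp_all add: ell2_def l2norm_def)

lemma l2norm_tail_tendsto_0:
  fixes c :: "nat \<Rightarrow> 'k::real_normed_vector"
  assumes "ell2 c"
  shows "(\<lambda>n. l2norm (\<lambda>i. if i < n then 0 else c i)) \<longlonglongrightarrow> 0"
proof -
  define f where "f = (\<lambda>i. (norm (c i))\<^sup>2)"
  have f: "f summable_on UNIV" using assms by (simp add: ell2_def f_def)
  have tail: "(l2norm (\<lambda>i. if i < n then 0 else c i))\<^sup>2 = (\<Sum>\<^sub>\<infinity>i. f i) - (\<Sum>i<n. f i)" for n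
  proof -
    have "(f has_sum (\<Sum>\<^sub>\<infinity>i. f i) - (\<Sum>i<n. f i)) (UNIV - {..<n})"
      by (rule has_sum_Diff) (use f in \<open>auto simp: has_sum_infsum intro: has_sum_finite\<close>)
    then have "(\<Sum>\<^sub>\<infinity>i\<in>UNIV - {..<n}. f i) = (\<Sum>\<^sub>\<infinity>i. f i) - (\<Sum>i<n. f i)"
      by (rule infsumI)
    moreover have "(\<Sum>\<^sub>\<infinity>i. (norm (if i < n then 0 else c i))\<^sup>2) = (\<Sum>\<^sub>\<infinity>i\<in>UNIV - {..<n}. f i)"
      by (rule infsum_cong_neutral) (auto simp: f_def)
    ultimately show ?thesis by (simp add: l2norm_square)
  qed
  have "(\<lambda>n. (\<Sum>\<^sub>\<infinity>i. f i) - (\<Sum>i<n. f i)) \<longlonglongrightarrow> (\<Sum>\<^sub>\<infinity>i. f i) - (\<Sum>\<^sub>\<infinity>i. f i)"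
    by (intro tendsto_intros has_sum_imp_sums[unfolded sums_def] has_sum_infsum f)
  then have "(\<lambda>n. sqrt ((l2norm (\<lambda>i. if i < n then 0 else c i))\<^sup>2)) \<longlonglongrightarrow> sqrt 0"
    unfolding tail by (intro tendsto_real_sqrt) simp
  then show ?thesis by simp
qed

section \<open>Synthesis and analysis\<close>

context hilbert_space
begin

definition synth :: "('i \<Rightarrow> 'h) \<Rightarrow> ('i \<Rightarrow> 'k) \<Rightarrow> 'h" where
  "synth w c = (\<Sum>\<^sub>\<infinity>i. smul (c i) (w i))"

definition bessel :: "('i \<Rightarrow> 'h) \<Rightarrow> real \<Rightarrow> bool" where
  "bessel w B \<longleftrightarrow> (\<forall>c. ell2 c \<longrightarrow>
     (\<lambda>i. smul (c i) (w i)) summable_on UNIV \<and> norm (synth w c) \<le> B * l2norm c)"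

definition bounded_below :: "('i \<Rightarrow> 'h) \<Rightarrow> real \<Rightarrow> bool" where
  "bounded_below w b \<longleftrightarrow> (\<forall>c. ell2 c \<longrightarrow> b * l2norm c \<le> norm (synth w c))"

definition injective :: "('i \<Rightarrow> 'h) \<Rightarrow> bool" where
  "injective w \<longleftrightarrow> (\<forall>c. ell2 c \<longrightarrow> synth w c = 0 \<longrightarrow> c = (\<lambda>_. 0))"

definition onto :: "('i \<Rightarrow> 'h) \<Rightarrow> bool" where
  "onto w \<longleftrightarrow> (\<forall>x. \<exists>c. ell2 c \<and> synth w c = x)"

lemma has_sum_synth:
  "bessel w B \<Longrightarrow> ell2 c \<Longrightarrow> ((\<lambda>i. smul (c i) (w i)) has_sum synth w c) UNIV"
  unfolding bessel_def synth_def by (blast intro: has_sum_infsum)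

lemma norm_synth_le: "bessel w B \<Longrightarrow> ell2 c \<Longrightarrow> norm (synth w c) \<le> B * l2norm c"
  unfolding bessel_def by blast

lemma bounded_belowD: "bounded_below w b \<Longrightarrow> ell2 c \<Longrightarrow> b * l2norm c \<le> norm (synth w c)"
  unfolding bounded_below_def by blast

lemma synth_add:
  assumes "bessel w B" "ell2 c" "ell2 d"
  shows "synth w (\<lambda>i. c i + d i) = synth w c + synth w d"
  using has_sum_add[OF has_sum_synth[OF assms(1,2)] has_sum_synth[OF assms(1,3)]]
  unfolding synth_def[of w "\<lambda>i. c i + d i"]
  by (intro infsumI) (simp add: scale_left_distrib)

lemma synth_scale:
  assumes "bessel w B" "ell2 c"
  shows "synth w (\<lambda>i. a * c i) = smul a (synth w c)"
  using has_sum_bounded_linear[OF bounded_linear_smul[of a] has_sum_synth[OF assms]]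
  unfolding synth_def[of w "\<lambda>i. a * c i"]
  by (intro infsumI) (simp add: o_def)

lemma synth_diff:
  assumes "bessel w B" "ell2 c" "ell2 d"
  shows "synth w (\<lambda>i. c i - d i) = synth w c - synth w d"
  using synth_add[OF assms(1) ell2_diff[OF assms(2,3)] assms(3)] by simp

lemma synth_zero [simp]: "synth w (\<lambda>_. 0) = 0"
  by (simp add: synth_def)

lemma synth_finite:
  assumes "finite F" "\<And>i. i \<notin> F \<Longrightarrow> c i = 0"
  shows "synth w c = (\<Sum>i\<in>F. smul (c i) (w i))"
  unfolding synth_def
  by (intro infsumI has_sum_finite_neutralI) (use assms in auto)

lemma bounded_below_injective:
  assumes "bounded_below w b" "b > 0"
  shows "injective w"
  unfolding injective_def
proof (intro allI impI ext)
  fix c i assume c: "ell2 c" "synth w c = 0"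
  have "b * l2norm c \<le> 0" using bounded_belowD[OF assms(1) c(1)] c(2) by simp
  then have "l2norm c \<le> 0" using assms(2) by (simp add: mult_le_0_iff)
  with norm_le_l2norm[OF c(1), of i] have "norm (c i) \<le> 0" by (rule order_trans)
  then show "c i = 0" by simp
qed

text \<open>Analysis is the adjoint of synthesis and so has the same bound: the partial sum
  \<open>q\<^sup>2 = \<Sum>i\<in>F. \<bar>\<langle>x, w i\<rangle>\<bar>\<^sup>2\<close> is the inner product of \<open>x\<close> with \<open>synth w c\<close>, where \<open>c\<close> is the analysis
  of \<open>x\<close> cut off to \<open>F\<close> and has norm \<open>q\<close>.\<close>

lemma ell2_analysis:
  assumes "bessel w B" "0 \<le> B"
  shows "ell2 (\<lambda>i. ip x (w i))" "l2norm (\<lambda>i. ip x (w i)) \<le> B * norm x"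
proof -
  have "L2_set (\<lambda>i. norm (ip x (w i))) F \<le> B * norm x" if F: "finite F" for F
  proof -
    define q where "q = L2_set (\<lambda>i. norm (ip x (w i))) F"
    define c where "c = (\<lambda>i. if i \<in> F then ip x (w i) else 0)"
    have c: "ell2 c" "(l2norm c)\<^sup>2 = (\<Sum>i\<in>F. (norm (c i))\<^sup>2)"
      using ell2_finite_support[OF F, of c] by (simp_all add: c_def)
    have "(\<Sum>i\<in>F. (norm (c i))\<^sup>2) = q\<^sup>2"
      unfolding q_def L2_set_def by (simp add: sum_nonneg c_def)
    with c(2) have "(l2norm c)\<^sup>2 = q\<^sup>2" by simp
    then have lq: "l2norm c = q"
      by (simp add: power2_eq_iff_nonneg q_def)
    have "ip x (synth w c) = (\<Sum>i\<in>F. cj (c i) * ip x (w i))"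
      by (subst synth_finite[OF F]) (auto simp: c_def ip_sum_right ip_scale_right)
    also have "\<dots> = (\<Sum>i\<in>F. of_real ((norm (c i))\<^sup>2))"
      by (rule sum.cong) (auto simp: c_def mult.commute[of "cj _"] mult_cj scaleR_conv_of_real)
    also have "\<dots> = of_real (q\<^sup>2)"
      using \<open>(\<Sum>i\<in>F. (norm (c i))\<^sup>2) = q\<^sup>2\<close> by (simp only: of_real_sum[symmetric])
    finally have "q\<^sup>2 = norm (ip x (synth w c))"
      by (simp add: norm_power)
    also have "\<dots> \<le> norm x * (B * q)"
      using ip_Cauchy_Schwarz norm_synth_le[OF assms(1) c(1)] lq
      by (metis mult_left_mono norm_ge_zero order_trans)
    finally have "q * q \<le> (B * norm x) * q"
      by (simp add: power2_eq_square ac_simps)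
    moreover have "0 \<le> q" by (simp add: q_def)
    ultimately show ?thesis
      using assms(2) unfolding q_def[symmetric]
      by (metis mult_nonneg_nonneg mult_le_cancel_right norm_ge_zero order_le_less)
  qed
  from ell2_bounded[OF this]
  show "ell2 (\<lambda>i. ip x (w i))" "l2norm (\<lambda>i. ip x (w i)) \<le> B * norm x" by blast+
qed

text \<open>Cauchy--Schwarz for the pairing of the coefficients with the analysis of \<open>x\<close>; it holds for
  finite partial sums and passes to the limit.\<close>

lemma norm_ip_synth_le:
  assumes "bessel w B" "0 \<le> B" "ell2 c"
  shows "norm (ip x (synth w c)) \<le> l2norm c * l2norm (\<lambda>i. ip x (w i))"
proof -
  have fin: "norm (\<Sum>i\<in>F. ip x (smul (c i) (w i))) \<le> l2norm c * l2norm (\<lambda>i. ip x (w i))"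
    if "finite F" for F
  proof -
    have "norm (\<Sum>i\<in>F. ip x (smul (c i) (w i))) \<le> (\<Sum>i\<in>F. \<bar>norm (c i)\<bar> * \<bar>norm (ip x (w i))\<bar>)"
      by (rule order_trans[OF norm_sum]) (simp add: ip_scale_right norm_mult norm_cj)
    also have "\<dots> \<le> L2_set (\<lambda>i. norm (c i)) F * L2_set (\<lambda>i. norm (ip x (w i))) F"
      by (rule L2_set_mult_ineq)
    also have "\<dots> \<le> l2norm c * l2norm (\<lambda>i. ip x (w i))"
      by (intro mult_mono L2_set_le_l2norm that assms ell2_analysis(1)[OF assms(1,2)]) simp_all
    finally show ?thesis .
  qed
  have "((\<lambda>i. ip x (smul (c i) (w i))) has_sum ip x (synth w c)) UNIV"
    using has_sum_bounded_linear[OF bounded_linear_ip_right[of x] has_sum_synth[OF assms(1,3)]]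
    by (simp add: o_def)
  then have "(sum (\<lambda>i. ip x (smul (c i) (w i))) \<longlongrightarrow> ip x (synth w c)) (finite_subsets_at_top UNIV)"
    by (simp add: has_sum_def)
  then show ?thesis
    by (rule tendsto_upperbound[OF tendsto_norm])
      (auto simp: eventually_finite_subsets_at_top intro: fin exI[of _ "{}"])
qed

lemma ip_synth_analysis:
  assumes "bessel w B" "0 \<le> B"
  shows "ip (synth w (\<lambda>i. ip y (w i))) y = of_real ((l2norm (\<lambda>i. ip y (w i)))\<^sup>2)"
proof -
  let ?c = "\<lambda>i. ip y (w i)"
  have c: "ell2 ?c" by (rule ell2_analysis(1)[OF assms])
  have "((\<lambda>i. ip (smul (?c i) (w i)) y) has_sum ip (synth w ?c) y) UNIV"
    using has_sum_bounded_linear[OF bounded_linear_ip_left[of y] has_sum_synth[OF assms(1) c]]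
    by (simp add: o_def)
  moreover have "ip (smul (?c i) (w i)) y = of_real ((norm (?c i))\<^sup>2)" for i
    using mult_cj[of "?c i"]
    by (simp only: ip_scale_left ip_commute[where y = "w i" and x = y] scaleR_conv_of_real mult_1_right)
  ultimately have 1: "((\<lambda>i. of_real ((norm (?c i))\<^sup>2) :: 'k) has_sum ip (synth w ?c) y) UNIV"
    by simp
  have "((\<lambda>i. (norm (?c i))\<^sup>2) has_sum (l2norm ?c)\<^sup>2) UNIV"
    using c unfolding ell2_def l2norm_square by (rule has_sum_infsum)
  from has_sum_bounded_linear[OF bounded_linear_of_real this]
  have 2: "((\<lambda>i. of_real ((norm (?c i))\<^sup>2) :: 'k) has_sum of_real ((l2norm ?c)\<^sup>2)) UNIV"
    by (simp add: o_def)
  show ?thesis using 1 2 by (rule has_sum_unique)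
qed

section \<open>Surjective synthesis and lower frame bounds\<close>

text \<open>Bounds are kept as bounds of norms throughout, so \<open>frame_below w a\<close> is a lower frame bound
  \<open>a\<^sup>2\<close> in the usual normalisation.\<close>

definition frame_below :: "('i \<Rightarrow> 'h) \<Rightarrow> real \<Rightarrow> bool" where
  "frame_below w a \<longleftrightarrow> (\<forall>x. a * norm x \<le> l2norm (\<lambda>i. ip x (w i)))"

text \<open>A surjection bounded below by \<open>b\<close> has an inverse of norm at most \<open>1 / b\<close>, hence so has its
  adjoint. Concretely, writing \<open>x = synth w c\<close> gives
  \<open>\<parallel>x\<parallel>\<^sup>2 = \<langle>x, synth w c\<rangle> \<le> \<parallel>c\<parallel> \<parallel>analysis of x\<parallel>\<close> with \<open>\<parallel>c\<parallel> \<le> \<parallel>x\<parallel> / b\<close>.\<close>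

lemma onto_bounded_below_frame_below:
  assumes "bessel w B" "0 \<le> B" "onto w" "bounded_below w b" "b > 0"
  shows "frame_below w b"
  unfolding frame_below_def
proof
  fix x
  obtain c where c: "ell2 c" "synth w c = x"
    using assms(3) unfolding onto_def by blast
  have "norm x * norm x = norm (ip x (synth w c))"
    by (metis c(2) ip_self norm_of_real abs_power2 power2_eq_square)
  also have "\<dots> \<le> l2norm c * l2norm (\<lambda>i. ip x (w i))"
    by (rule norm_ip_synth_le[OF assms(1,2) c(1)])
  also have "b * \<dots> \<le> norm x * l2norm (\<lambda>i. ip x (w i))"
    using mult_right_mono[OF bounded_belowD[OF assms(4) c(1)], of "l2norm (\<lambda>i. ip x (w i))"]
    by (simp add: c(2) mult.assoc)
  finally have "norm x * (b * norm x) \<le> norm x * l2norm (\<lambda>i. ip x (w i))"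
    using assms(5) by (simp add: ac_simps)
  then show "b * norm x \<le> l2norm (\<lambda>i. ip x (w i))"
    by (cases "x = 0") simp_all
qed

text \<open>With \<open>S\<close> the frame operator, the equation \<open>S y = z\<close> is solved by the iteration
  \<open>y \<mapsto> y + t (z - S y)\<close> with \<open>t = 1 / B\<^sup>2\<close>. It contracts because
  \<open>\<parallel>x - t S x\<parallel>\<^sup>2 = \<parallel>x\<parallel>\<^sup>2 - 2 t \<langle>S x, x\<rangle> + t\<^sup>2 \<parallel>S x\<parallel>\<^sup>2\<close>, where the last term is at most
  \<open>t \<langle>S x, x\<rangle>\<close> by the Bessel bound and \<open>\<langle>S x, x\<rangle> \<ge> a\<^sup>2 \<parallel>x\<parallel>\<^sup>2\<close> by the frame bound.\<close>

lemma frame_operator_surjective: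
  assumes w: "bessel w B" and B: "0 < B" and a: "frame_below w a" "0 < a"
  shows "\<exists>y. synth w (\<lambda>i. ip y (w i)) = z"
proof -
  define S where "S = (\<lambda>y. synth w (\<lambda>i. ip y (w i)))"
  define t where "t = 1 / B\<^sup>2"
  define f where "f = (\<lambda>y. y + t *\<^sub>R (z - S y))"
  \<comment> \<open>The minimum keeps the square root real when the given bounds are not known to be ordered.\<close>
  define k where "k = sqrt (1 - (min a B)\<^sup>2 / B\<^sup>2)"
  note an = ell2_analysis[OF w less_imp_le[OF B]]
  have t: "t > 0" "t * B\<^sup>2 = 1" using B by (simp_all add: t_def)
  have aB: "(min a B)\<^sup>2 / B\<^sup>2 \<le> 1" "0 < (min a B)\<^sup>2 / B\<^sup>2"
    using B a(2) by (auto simp: divide_le_eq_1 power2_le_iff_abs_le)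
  have k: "0 \<le> k" "k < 1" "k\<^sup>2 = 1 - (min a B)\<^sup>2 / B\<^sup>2"
    using aB by (auto simp: k_def real_sqrt_lt_1_iff)
  have S_diff: "S (x - y) = S x - S y" for x y
    unfolding S_def ip_diff_left by (rule synth_diff[OF w an(1) an(1)])
  have contr: "norm (x - t *\<^sub>R S x) \<le> k * norm x" for x
  proof -
    define q where "q = (l2norm (\<lambda>i. ip x (w i)))\<^sup>2"
    have Sx: "ip (S x) x = of_real q"
      unfolding S_def q_def by (rule ip_synth_analysis[OF w less_imp_le[OF B]])
    then have xS: "ip x (S x) = of_real q"
      by (metis ip_commute cj_of_real)
    have "ip (x - t *\<^sub>R S x) (x - t *\<^sub>R S x)
        = of_real ((norm x)\<^sup>2 - 2 * t * q + t\<^sup>2 * (norm (S x))\<^sup>2)"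
      unfolding ip_diff_left ip_diff_right ip_scaleR_left ip_scaleR_right Sx xS
        ip_self[of x] ip_self[of "S x"]
      by (simp add: scaleR_conv_of_real algebra_simps power2_eq_square)
    then have 1: "(norm (x - t *\<^sub>R S x))\<^sup>2 = (norm x)\<^sup>2 - 2 * t * q + t\<^sup>2 * (norm (S x))\<^sup>2"
      unfolding ip_self of_real_eq_iff .
    have "(norm (S x))\<^sup>2 \<le> B\<^sup>2 * q"
      using power_mono[OF norm_synth_le[OF w an(1)[of x]] norm_ge_zero, of 2]
      by (simp add: S_def q_def power_mult_distrib)
    then have "t\<^sup>2 * (norm (S x))\<^sup>2 \<le> t\<^sup>2 * (B\<^sup>2 * q)"
      by (simp add: mult_left_mono)
    also have "\<dots> = t * q"
      using t(2) by (metis mult.assoc mult.left_commute mult_1_right power2_eq_square)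
    finally have 2: "t\<^sup>2 * (norm (S x))\<^sup>2 \<le> t * q" .
    have "min a B * norm x \<le> l2norm (\<lambda>i. ip x (w i))"
      using a(1) mult_right_mono[of "min a B" a "norm x"] unfolding frame_below_def
      by (meson min.cobounded1 norm_ge_zero order_trans)
    then have "(min a B)\<^sup>2 * (norm x)\<^sup>2 \<le> q"
      unfolding q_def power_mult_distrib[symmetric] using a(2) B by (intro power_mono) simp_all
    then have "t * ((min a B)\<^sup>2 * (norm x)\<^sup>2) \<le> t * q"
      using t(1) by (simp add: mult_left_mono)
    with 1 2 have "(norm (x - t *\<^sub>R S x))\<^sup>2 \<le> (norm x)\<^sup>2 - t * ((min a B)\<^sup>2 * (norm x)\<^sup>2)"
      by linarith
    also have "\<dots> = (k * norm x)\<^sup>2"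
      by (simp add: k(3) power_mult_distrib t_def algebra_simps)
    finally show ?thesis
      by (rule power2_le_imp_le) (simp add: k(1))
  qed
  have "dist (f x) (f y) \<le> k * dist x y" for x y
  proof -
    have "f x - f y = (x - y) - t *\<^sub>R S (x - y)"
      by (simp add: f_def S_diff algebra_simps)
    then show ?thesis using contr[of "x - y"] by (simp add: dist_norm)
  qed
  with banach_fix_type[OF k(1,2), of f] have "\<exists>!y. f y = y" by blast
  then obtain y where "f y = y" by blast
  then have "S y = z" using t(1) by (simp add: f_def)
  then show ?thesis unfolding S_def by blast
qed

text \<open>The preimage obtained through the frame operator is the analysis of some \<open>y\<close>, and
  \<open>\<parallel>c\<parallel>\<^sup>2 = \<langle>x, y\<rangle> \<le> \<parallel>x\<parallel> \<parallel>y\<parallel> \<le> \<parallel>x\<parallel> \<parallel>c\<parallel> / a\<close>. Thus the frame bound itself bounds a right inverse of synthesis;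
  with injectivity this becomes a lower bound for synthesis.\<close>

lemma frame_below_preimage:
  assumes w: "bessel w B" and B: "0 < B" and a: "frame_below w a" "0 < a"
  obtains c where "ell2 c" "synth w c = x" "a * l2norm c \<le> norm x"
proof -
  obtain y where y: "synth w (\<lambda>i. ip y (w i)) = x"
    using frame_operator_surjective[OF assms] by blast
  define c where "c = (\<lambda>i. ip y (w i))"
  have "(l2norm c)\<^sup>2 = norm (ip x y)"
    using ip_synth_analysis[OF w less_imp_le[OF B], of y] by (simp add: c_def y norm_power)
  also have "\<dots> \<le> norm x * norm y" by (rule ip_Cauchy_Schwarz)
  finally have "a * (l2norm c)\<^sup>2 \<le> norm x * (a * norm y)"
    using a(2) by (simp add: ac_simps)
  also have "\<dots> \<le> norm x * l2norm c"
    using a(1) unfolding frame_below_def c_def by (intro mult_left_mono) simp_all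
  finally have "l2norm c * (a * l2norm c) \<le> l2norm c * norm x"
    by (simp add: power2_eq_square ac_simps)
  then have "a * l2norm c \<le> norm x"
    by (cases "l2norm c = 0") (use l2norm_nonneg[of c] in \<open>auto simp: less_le\<close>)
  moreover have "ell2 c" unfolding c_def by (rule ell2_analysis(1)[OF w less_imp_le[OF B]])
  ultimately show thesis using that y c_def by blast
qed

lemma frame_below_onto:
  "bessel w B \<Longrightarrow> 0 < B \<Longrightarrow> frame_below w a \<Longrightarrow> 0 < a \<Longrightarrow> onto w"
  unfolding onto_def by (meson frame_below_preimage)

lemma frame_below_injective_bounded_below:
  fixes w :: "'i \<Rightarrow> 'h"
  assumes w: "bessel w B" and B: "0 < B" and a: "frame_below w a" "0 < a" and "injective w"
  shows "bounded_below w a"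
  unfolding bounded_below_def
proof (intro allI impI)
  fix c :: "'i \<Rightarrow> 'k" assume c: "ell2 c"
  obtain d where d: "ell2 d" "synth w d = synth w c" "a * l2norm d \<le> norm (synth w c)"
    using frame_below_preimage[OF w B a] .
  have "synth w (\<lambda>i. c i - d i) = 0"
    using synth_diff[OF w c d(1)] d(2) by simp
  then have "(\<lambda>i. c i - d i) = (\<lambda>_. 0)"
    using \<open>injective w\<close> ell2_diff[OF c d(1)] unfolding injective_def by blast
  then have "c = d" by (auto simp: fun_eq_iff)
  with d(3) show "a * l2norm c \<le> norm (synth w c)" by simp
qed

end
section \<open>Riesz sequences and closed spans\<close>

context hilbert_space
begin

lemma span_image_synth:
  assumes w: "bessel w B" and x: "x \<in> span (w ` I)"
  obtains c where "ell2 c" "\<And>i. i \<notin> I \<Longrightarrow> c i = 0" "synth w c = x"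
proof -
  let ?R = "{synth w c | c. ell2 c \<and> (\<forall>i. i \<notin> I \<longrightarrow> c i = 0)}"
  have "span (w ` I) \<subseteq> ?R"
  proof (rule span_minimal)
    show "w ` I \<subseteq> ?R"
    proof
      fix y assume "y \<in> w ` I"
      then obtain j where j: "j \<in> I" "y = w j" by blast
      let ?e = "\<lambda>i. if i = j then 1 else 0 :: 'k"
      have "ell2 ?e" by (rule ell2_finite_support(1)[of "{j}"]) auto
      moreover have "synth w ?e = y" by (subst synth_finite[of "{j}"]) (auto simp: j)
      ultimately show "y \<in> ?R" using j(1) by (auto intro!: exI[of _ ?e])
    qed
    show "subspace ?R"
    proof (rule subspaceI)
      show "0 \<in> ?R" by (auto intro!: exI[of _ "\<lambda>_. 0"])
    next
      fix x y assume "x \<in> ?R" "y \<in> ?R"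
      then obtain c d where "ell2 c" "\<forall>i. i \<notin> I \<longrightarrow> c i = 0" "x = synth w c"
        "ell2 d" "\<forall>i. i \<notin> I \<longrightarrow> d i = 0" "y = synth w d" by blast
      then show "x + y \<in> ?R"
        using synth_add[OF w] ell2_add(1)[of c d] by (auto intro!: exI[of _ "\<lambda>i. c i + d i"])
    next
      fix a x assume "x \<in> ?R"
      then obtain c where "ell2 c" "\<forall>i. i \<notin> I \<longrightarrow> c i = 0" "x = synth w c" by blast
      then show "smul a x \<in> ?R"
        using synth_scale[OF w] ell2_scale(1)[of c a] by (auto intro!: exI[of _ "\<lambda>i. a * c i"])
    qed
  qed
  with x that show thesis by blast
qed

lemma synth_in_closed_span:
  assumes w: "bessel w B" and c: "ell2 c" "\<And>i. i \<notin> I \<Longrightarrow> c i = 0"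
  shows "synth w c \<in> closed_span smul (w ` I)"
proof -
  have "smul (c i) (w i) \<in> span (w ` I)" for i
    by (cases "i \<in> I") (auto simp: c(2) span_zero span_base span_scale)
  then have *: "(\<Sum>i\<in>F. smul (c i) (w i)) \<in> closure (span (w ` I))" for F
    by (intro subsetD[OF closure_subset] span_sum)
  have "(sum (\<lambda>i. smul (c i) (w i)) \<longlongrightarrow> synth w c) (finite_subsets_at_top UNIV)"
    using has_sum_synth[OF w c(1)] by (simp add: has_sum_def)
  then have "synth w c \<in> closure (span (w ` I))"
    by (rule Lim_in_closed_set[rotated 3]) (use * in auto)
  then show ?thesis by (simp add: closed_span_def)
qed

lemma closed_span_scaleR:
  assumes "x \<in> closed_span smul S"
  shows "r *\<^sub>R x \<in> closed_span smul S"
proof -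
  have "(*\<^sub>R) r ` span S \<subseteq> span S"
    by (auto simp: scale_of_real[symmetric] span_scale)
  then have "(*\<^sub>R) r ` closure (span S) \<subseteq> closure (span S)"
    unfolding closure_scaleR by (rule closure_mono)
  with assms show ?thesis by (auto simp: closed_span_def)
qed

text \<open>The range of a synthesis map that is bounded below is closed: if \<open>synth w (C n)\<close> converges, then
  the sequences \<open>C n\<close> are Cauchy in the square norm and their coordinatewise limit is a preimage of the
  limit. So a Riesz sequence with dense span synthesises every vector.\<close>

lemma bounded_below_dense_onto:
  assumes w: "bessel w B" "bounded_below w b" "b > 0"
    and dense: "closed_span smul (range w) = UNIV"
  shows "onto w"
  unfolding onto_def
proof
  fix x
  show "\<exists>c. ell2 c \<and> synth w c = x"
  proof (cases "x = 0")
    case True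
    then show ?thesis by (intro exI[of _ "\<lambda>_. 0"]) simp
  next
    case False
    from dense have "x \<in> closure (span (range w))" by (auto simp: closed_span_def)
    then obtain s where s: "\<And>n. s n \<in> span (range w)" "s \<longlonglongrightarrow> x"
      by (auto simp: closure_sequential)
    have "\<exists>c. ell2 c \<and> synth w c = s n" for n
      using span_image_synth[OF w(1) s(1)] by metis
    then obtain C where C: "\<And>n. ell2 (C n)" "\<And>n. synth w (C n) = s n" by metis
    have diff: "l2norm (\<lambda>i. C n i - C m i) \<le> norm (s n - s m) / b" for n m
      using bounded_belowD[OF w(2) ell2_diff[OF C(1) C(1)], of n m] w(3)
        synth_diff[OF w(1) C(1) C(1), of n m] C(2)
      by (simp add: field_simps)
    have close: "\<exists>N. \<forall>n\<ge>N. \<forall>m\<ge>N. l2norm (\<lambda>i. C n i - C m i) < e" if "e > 0" for e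
    proof -
      have "Cauchy s" using s(2) by (rule LIMSEQ_imp_Cauchy)
      moreover have "0 < e * b" using that w(3) by simp
      ultimately obtain N where "\<forall>n\<ge>N. \<forall>m\<ge>N. norm (s n - s m) < e * b"
        using CauchyD by blast
      then have "\<forall>n\<ge>N. \<forall>m\<ge>N. norm (s n - s m) / b < e"
        using w(3) by (simp add: pos_divide_less_eq)
      then show ?thesis using diff order_le_less_trans by blast
    qed
    have "convergent (\<lambda>n. C n i)" for i
    proof (rule convergent_scalars[OF False], rule CauchyI)
      fix e :: real assume "e > 0"
      from close[OF this] show "\<exists>M. \<forall>m\<ge>M. \<forall>n\<ge>M. norm (C m i - C n i) < e"
        using norm_le_l2norm[OF ell2_diff[OF C(1) C(1)]] by (meson order_le_less_trans)
    qed
    then obtain c where c: "\<And>i. (\<lambda>n. C n i) \<longlonglongrightarrow> c i"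
      unfolding convergent_def by metis
    \<comment> \<open>Coordinatewise convergence becomes convergence in norm by letting \<open>m\<close> tend to infinity in
      the Cauchy condition, one finite index set at a time.\<close>
    have tail: "\<exists>N. \<forall>n\<ge>N. ell2 (\<lambda>i. C n i - c i) \<and> l2norm (\<lambda>i. C n i - c i) \<le> e"
      if "e > 0" for e
    proof -
      obtain N where N: "\<And>n m. n \<ge> N \<Longrightarrow> m \<ge> N \<Longrightarrow> l2norm (\<lambda>i. C n i - C m i) < e"
        using close[OF \<open>e > 0\<close>] by blast
      have "ell2 (\<lambda>i. C n i - c i) \<and> l2norm (\<lambda>i. C n i - c i) \<le> e" if "n \<ge> N" for n
      proof -
        have "L2_set (\<lambda>i. norm (C n i - c i)) F \<le> e" if F: "finite F" for F
        proof (rule tendsto_upperbound)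
          show "(\<lambda>m. L2_set (\<lambda>i. norm (C n i - C m i)) F) \<longlonglongrightarrow> L2_set (\<lambda>i. norm (C n i - c i)) F"
            unfolding L2_set_def by (intro tendsto_intros c)
          show "\<forall>\<^sub>F m in sequentially. L2_set (\<lambda>i. norm (C n i - C m i)) F \<le> e"
            unfolding eventually_sequentially
            using order_trans[OF L2_set_le_l2norm[OF ell2_diff[OF C(1) C(1)] F]
                less_imp_le[OF N[OF \<open>n \<ge> N\<close>]]] by blast
        qed simp
        from ell2_bounded[OF this] show ?thesis by blast
      qed
      then show ?thesis by blast
    qed
    obtain N where "ell2 (\<lambda>i. C N i - c i)"
      using tail[of 1] by auto
    from ell2_diff[OF C(1)[of N] this] have ell2c: "ell2 c" by simp
    have "(\<lambda>n. l2norm (\<lambda>i. C n i - c i)) \<longlonglongrightarrow> 0"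
    proof (rule LIMSEQ_I)
      fix r :: real assume "r > 0"
      then obtain N where "\<And>n. n \<ge> N \<Longrightarrow> l2norm (\<lambda>i. C n i - c i) \<le> r / 2"
        using tail[of "r / 2"] by auto
      with \<open>r > 0\<close> show "\<exists>no. \<forall>n\<ge>no. norm (l2norm (\<lambda>i. C n i - c i) - 0) < r"
        by (intro exI[of _ N]) (fastforce dest: order_le_less_trans[of _ "r / 2" r])
    qed
    then have lim: "(\<lambda>n. B * l2norm (\<lambda>i. C n i - c i)) \<longlonglongrightarrow> 0"
      by (rule tendsto_mult_right_zero)
    have "(\<lambda>n. s n - synth w c) \<longlonglongrightarrow> 0"
      using norm_synth_le[OF w(1) ell2_diff[OF C(1) ell2c]] synth_diff[OF w(1) C(1) ell2c] C(2)
      by (intro Lim_null_comparison[OF _ lim]) simp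
    then have "s \<longlonglongrightarrow> synth w c" by (simp add: LIM_zero_iff)
    with s(2) have "synth w c = x" by (rule LIMSEQ_unique[rotated])
    with ell2c show ?thesis by blast
  qed
qed

lemma riesz_bounds_bounded:
  assumes "riesz_bounds smul UNIV w A B"
  shows "bessel w (sqrt B)" "bounded_below w (sqrt A)"
proof -
  have AB: "0 < A" "0 < B" using assms unfolding riesz_bounds_def by auto
  have *: "(\<lambda>i. smul (c i) (w i)) summable_on UNIV" "A * (l2norm c)\<^sup>2 \<le> (norm (synth w c))\<^sup>2"
    "(norm (synth w c))\<^sup>2 \<le> B * (l2norm c)\<^sup>2" if "ell2 c" for c
    using assms that unfolding riesz_bounds_def ell2_def l2norm_square synth_def by blast+
  show "bessel w (sqrt B)"
    unfolding bessel_def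
  proof (intro allI impI conjI *(1))
    fix c :: "'a \<Rightarrow> 'k" assume "ell2 c"
    from real_sqrt_le_mono[OF *(3)[OF this]] show "norm (synth w c) \<le> sqrt B * l2norm c"
      by (simp add: real_sqrt_mult)
  qed
  show "bounded_below w (sqrt A)"
    unfolding bounded_below_def
  proof (intro allI impI)
    fix c :: "'a \<Rightarrow> 'k" assume "ell2 c"
    from real_sqrt_le_mono[OF *(2)[OF this]] show "sqrt A * l2norm c \<le> norm (synth w c)"
      by (simp add: real_sqrt_mult)
  qed
qed

lemma frame_bounds_frame_below:
  assumes "frame_bounds ip UNIV w A B"
  shows "frame_below w (sqrt A)"
  unfolding frame_below_def
proof
  fix x
  have "A * (norm x)\<^sup>2 \<le> (l2norm (\<lambda>i. ip x (w i)))\<^sup>2"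
    using assms unfolding frame_bounds_def l2norm_square by blast
  from real_sqrt_le_mono[OF this] show "sqrt A * norm x \<le> l2norm (\<lambda>i. ip x (w i))"
    by (simp add: real_sqrt_mult)
qed

lemma frame_boundsI:
  assumes "bessel w B" "0 < B" "frame_below w a" "0 < a"
  shows "frame_bounds ip UNIV w (a\<^sup>2) ((a + B)\<^sup>2)"
  unfolding frame_bounds_def l2norm_square[symmetric]
proof (intro conjI allI)
  fix x
  note an = ell2_analysis[OF assms(1) less_imp_le[OF assms(2)], of x]
  show "(\<lambda>i. (norm (ip x (w i)))\<^sup>2) summable_on UNIV"
    using an(1) by (simp add: ell2_def)
  show "a\<^sup>2 * (norm x)\<^sup>2 \<le> (l2norm (\<lambda>i. ip x (w i)))\<^sup>2"
    using assms(3,4) unfolding frame_below_def power_mult_distrib[symmetric]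
    by (intro power_mono) auto
  have "l2norm (\<lambda>i. ip x (w i)) \<le> (a + B) * norm x"
    using an(2) assms(4) by (rule_tac order_trans) (auto intro: mult_right_mono)
  then show "(l2norm (\<lambda>i. ip x (w i)))\<^sup>2 \<le> (a + B)\<^sup>2 * (norm x)\<^sup>2"
    unfolding power_mult_distrib[symmetric] by (rule power_mono) simp
qed (use assms in \<open>auto intro: power_mono\<close>)

end
section \<open>Changing one vector\<close>

context hilbert_space
begin

lemma synth_change_one:
  assumes w: "bessel w B" and eq: "\<And>i. i \<noteq> j \<Longrightarrow> w' i = w i" and c: "ell2 c"
  shows "synth w c = synth w' c - smul (c j) (w' j - w j)"
proof -
  let ?f = "\<lambda>i. if i = j then smul (c j) (w' j - w j) else 0"
  have "(?f has_sum smul (c j) (w' j - w j)) UNIV"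
    by (rule has_sum_finite_neutralI[of "{j}"]) auto
  from has_sum_add[OF has_sum_synth[OF w c] this]
  have "((\<lambda>i. smul (c i) (w' i)) has_sum synth w c + smul (c j) (w' j - w j)) UNIV"
    by (rule has_sum_cong[THEN iffD1, rotated]) (auto simp: eq scale_right_diff_distrib)
  then have "synth w' c = synth w c + smul (c j) (w' j - w j)"
    unfolding synth_def[of w'] by (rule infsumI)
  then show ?thesis by simp
qed

text \<open>Let \<open>y = w' j - w j\<close> and let \<open>c\<close> be a preimage of \<open>y\<close> under synthesis with \<open>w'\<close>. Then
  \<open>synth w c = (1 - c j) y\<close>, so the scalar \<open>1 - c j\<close> decides whether the rank-one change of \<open>w'\<close> to
  \<open>w\<close> keeps synthesis invertible, as \<open>1 - v inverse(A) u\<close> does for a rank-one change \<open>A - u v\<close> of a matrix.\<close>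

lemma change_one_coefficient:
  assumes w: "bessel w B" and eq: "\<And>i. i \<noteq> j \<Longrightarrow> w' i = w i" and inj: "injective w"
    and c: "ell2 c" "synth w' c = w' j - w j"
  shows "c j \<noteq> 1"
proof
  assume "c j = 1"
  then have "synth w c = 0" by (simp add: synth_change_one[OF w eq c(1)] c(2))
  then have "c = (\<lambda>_. 0)" using inj c(1) unfolding injective_def by blast
  with \<open>c j = 1\<close> show False by simp
qed

text \<open>Since \<open>1 - c j \<noteq> 0\<close>, the vector \<open>y\<close> lies in the range of the changed synthesis; and every
  vector lies there up to a multiple of \<open>y\<close>.\<close>

lemma change_one_onto:
  assumes w: "bessel w B" and eq: "\<And>i. i \<noteq> j \<Longrightarrow> w' i = w i"
    and onto: "onto w'" and inj: "injective w"
  shows "onto w"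
  unfolding onto_def
proof
  fix x
  define y where "y = w' j - w j"
  obtain c where c: "ell2 c" "synth w' c = y" using onto unfolding onto_def by blast
  obtain a where a: "ell2 a" "synth w' a = x" using onto unfolding onto_def by blast
  have c1: "c j \<noteq> 1"
    using change_one_coefficient[OF w eq inj c(1)] c(2) by (simp add: y_def)
  define t where "t = a j / (1 - c j)"
  have change: "synth w d = synth w' d - smul (d j) y" if "ell2 d" for d
    unfolding y_def by (rule synth_change_one[OF w eq that])
  have "synth w c = smul (1 - c j) y"
    by (simp add: change[OF c(1)] c(2) scale_left_diff_distrib)
  moreover have "synth w a = x - smul (a j) y"
    by (simp add: change[OF a(1)] a(2))
  moreover have "synth w (\<lambda>i. a i + t * c i) = synth w a + smul t (synth w c)"
    by (simp only: synth_add[OF w a(1) ell2_scale(1)[OF c(1)]] synth_scale[OF w c(1)])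
  moreover have "t * (1 - c j) = a j" using c1 by (simp add: t_def)
  ultimately have "synth w (\<lambda>i. a i + t * c i) = x" by simp
  moreover have "ell2 (\<lambda>i. a i + t * c i)"
    by (rule ell2_add(1)[OF a(1) ell2_scale(1)[OF c(1)]])
  ultimately show "\<exists>d. ell2 d \<and> synth w d = x" by blast
qed

text \<open>A nonzero kernel element \<open>a\<close> must be \<open>a j\<close> times \<open>c\<close>, which forces \<open>c j = 1\<close>. Then every vector
  in the range of the changed synthesis is \<open>synth w' d\<close> for some \<open>d\<close> with \<open>d j = 0\<close>, so that
  \<open>w' j\<close> is missed.\<close>

lemma change_one_injective:
  assumes w: "bessel w B" and w': "bessel w' B'" and eq: "\<And>i. i \<noteq> j \<Longrightarrow> w' i = w i"
    and onto': "onto w'" and inj': "injective w'" and onto: "onto w"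
  shows "injective w"
  unfolding injective_def
proof (intro allI impI)
  fix a assume a: "ell2 a" "synth w a = 0"
  define y where "y = w' j - w j"
  have inj0: "d = d'" if "ell2 d" "ell2 d'" "synth w' d = synth w' d'" for d d'
  proof -
    have "(\<lambda>i. d i - d' i) = (\<lambda>_. 0)"
      using inj' ell2_diff[OF that(1,2)] synth_diff[OF w' that(1,2)] that(3)
      unfolding injective_def by simp
    then show ?thesis by (auto simp: fun_eq_iff)
  qed
  have change: "synth w' d = synth w d + smul (d j) y" if "ell2 d" for d
    unfolding y_def by (simp add: synth_change_one[OF w eq that])
  obtain c where c: "ell2 c" "synth w' c = y" using onto' unfolding onto_def by blast
  have "synth w' a = synth w' (\<lambda>i. a j * c i)"
    by (simp add: change[OF a(1)] a(2) c(2) synth_scale[OF w' c(1)])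
  then have ac: "a = (\<lambda>i. a j * c i)"
    by (rule inj0[OF a(1) ell2_scale(1)[OF c(1)]])
  show "a = (\<lambda>_. 0)"
  proof (cases "a j = 0")
    case True
    with ac show ?thesis by simp
  next
    case False
    with ac have cj1: "c j = 1" by (metis mult_cancel_left2)
    obtain b where b: "ell2 b" "synth w b = w' j" using onto unfolding onto_def by blast
    let ?e = "\<lambda>i. if i = j then 1 else 0 :: 'k"
    have e: "ell2 ?e" "synth w' ?e = w' j"
      using ell2_finite_support(1)[of "{j}" ?e] synth_finite[of "{j}" ?e w'] by auto
    have "synth w' (\<lambda>i. b i - b j * c i) = synth w' ?e"
      by (simp add: synth_diff[OF w' b(1) ell2_scale(1)[OF c(1)]] synth_scale[OF w' c(1)] c(2)
          change[OF b(1)] b(2) e(2))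
    then have "(\<lambda>i. b i - b j * c i) = ?e"
      by (rule inj0[OF ell2_diff[OF b(1) ell2_scale(1)[OF c(1)]] e(1)])
    from fun_cong[OF this, of j] show ?thesis by (simp add: cj1)
  qed
qed

end

section \<open>Weavings of two Riesz bases\<close>

text \<open>Subsets of the natural numbers are points of the Cantor space; the sets that agree with \<open>\<sigma>\<close> below
  \<open>N\<close> form the basic neighbourhoods of \<open>\<sigma>\<close>.\<close>

definition agree :: "nat \<Rightarrow> nat set \<Rightarrow> nat set \<Rightarrow> bool" where
  "agree N \<sigma> \<tau> \<longleftrightarrow> (\<forall>i<N. i \<in> \<sigma> \<longleftrightarrow> i \<in> \<tau>)"

definition flip :: "nat \<Rightarrow> nat set \<Rightarrow> nat set" where
  "flip j \<sigma> = {i. (i \<in> \<sigma>) \<noteq> (i = j)}"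

lemma flip_flip [simp]: "flip j (flip j \<sigma>) = \<sigma>"
  by (auto simp: flip_def)

lemma agree_flip: "agree N (flip j \<sigma>) \<tau> \<Longrightarrow> agree N \<sigma> (flip j \<tau>)"
  by (auto simp: agree_def flip_def)

lemma agree_trans: "agree N \<sigma> \<tau> \<Longrightarrow> agree N \<tau> \<rho> \<Longrightarrow> agree N \<sigma> \<rho>"
  by (auto simp: agree_def)

lemma agree_mono: "agree M \<sigma> \<tau> \<Longrightarrow> N \<le> M \<Longrightarrow> agree N \<sigma> \<tau>"
  by (auto simp: agree_def)

lemma weaving_flip: "i \<noteq> j \<Longrightarrow> weaving (flip j \<sigma>) \<phi> \<psi> i = weaving \<sigma> \<phi> \<psi> i"
  by (simp add: weaving_def flip_def)

lemma weaving_UNIV: "weaving UNIV \<phi> \<psi> = \<phi>"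
  by (simp add: weaving_def fun_eq_iff)

lemma weaving_empty: "weaving {} \<phi> \<psi> = \<psi>"
  by (simp add: weaving_def fun_eq_iff)

lemma finite_change_induct:
  assumes "finite {i. (i \<in> \<rho>) \<noteq> (i \<in> \<sigma>)}" "P \<rho>" "\<And>\<tau> j. P \<tau> \<Longrightarrow> P (flip j \<tau>)"
  shows "P \<sigma>"
proof -
  have "P \<sigma>" if "finite F" "{i. (i \<in> \<rho>) \<noteq> (i \<in> \<sigma>)} = F" for F \<sigma>
    using that
  proof (induction F arbitrary: \<sigma> rule: finite_induct)
    case empty
    then have "\<sigma> = \<rho>" by auto
    with assms(2) show ?case by simp
  next
    case (insert j F)
    then have "{i. (i \<in> \<rho>) \<noteq> (i \<in> flip j \<sigma>)} = F" by (auto simp: flip_def)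
    then have "P (flip j \<sigma>)" by (rule insert.IH)
    from assms(3)[OF this, of j] show ?case by simp
  qed
  with assms(1) show ?thesis by blast
qed

text \<open>Completeness of the Cantor space: since \<open>i < N (Suc i)\<close>, membership of \<open>i\<close> is settled from
  stage \<open>Suc i\<close> on.\<close>

lemma nested_cylinders_limit:
  assumes "\<And>n. agree (N n) (s n) (s (Suc n))" "\<And>n. N n < N (Suc n)"
  obtains \<sigma> where "\<And>n. agree (N n) (s n) \<sigma>"
proof
  have mono: "N m \<le> N n" if "m \<le> n" for m n
    using that assms(2) by (simp add: lift_Suc_mono_le less_imp_le)
  have chain: "agree (N m) (s m) (s n)" if "m \<le> n" for m n
    using that
  proof (induction n rule: dec_induct)
    case (step n)
    then show ?case using agree_trans agree_mono[OF assms(1) mono] by blast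
  qed (simp add: agree_def)
  have ge: "n \<le> N n" for n
    by (induction n) (use assms(2) Suc_leI order_le_less_trans in blast)+
  show "agree (N n) (s n) {i. i \<in> s (Suc i)}" for n
    unfolding agree_def
  proof (intro allI impI)
    fix i assume i: "i < N n"
    have "i \<in> s n \<longleftrightarrow> i \<in> s (Suc i)"
    proof (cases "n \<le> Suc i")
      case True
      from chain[OF this] i show ?thesis unfolding agree_def by blast
    next
      case False
      then have "agree (N (Suc i)) (s (Suc i)) (s n)" by (intro chain) simp
      then show ?thesis using ge[of "Suc i"] unfolding agree_def by (meson Suc_le_lessD)
    qed
    then show "i \<in> s n \<longleftrightarrow> i \<in> {i. i \<in> s (Suc i)}" by simp
  qed
qed

lemma (in hilbert_space) bessel_weaving:
  assumes \<phi>: "bessel \<phi> B" and \<psi>: "bessel \<psi> B'" and B: "0 \<le> B" "0 \<le> B'"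
  shows "ell2 c \<Longrightarrow> synth (weaving \<sigma> \<phi> \<psi>) c =
      synth \<phi> (\<lambda>i. if i \<in> \<sigma> then c i else 0) + synth \<psi> (\<lambda>i. if i \<in> \<sigma> then 0 else c i)"
    and "bessel (weaving \<sigma> \<phi> \<psi>) (B + B')"
proof -
  have *: "((\<lambda>i. smul (c i) (weaving \<sigma> \<phi> \<psi> i)) has_sum
      synth \<phi> (\<lambda>i. if i \<in> \<sigma> then c i else 0) + synth \<psi> (\<lambda>i. if i \<in> \<sigma> then 0 else c i)) UNIV"
    (is "(_ has_sum synth \<phi> ?c1 + synth \<psi> ?c2) UNIV") if c: "ell2 c" for c
  proof -
    have "ell2 ?c1" "ell2 ?c2" by (rule ell2_mono(1)[OF c]; simp)+
    from has_sum_add[OF has_sum_synth[OF \<phi> this(1)] has_sum_synth[OF \<psi> this(2)]]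
    show ?thesis
      by (rule has_sum_cong[THEN iffD1, rotated]) (simp add: weaving_def)
  qed
  then show eq: "synth (weaving \<sigma> \<phi> \<psi>) c =
      synth \<phi> (\<lambda>i. if i \<in> \<sigma> then c i else 0) + synth \<psi> (\<lambda>i. if i \<in> \<sigma> then 0 else c i)"
    if "ell2 c" for c
    unfolding synth_def[of "weaving \<sigma> \<phi> \<psi>"] using that by (intro infsumI)
  show "bessel (weaving \<sigma> \<phi> \<psi>) (B + B')"
    unfolding bessel_def
  proof (intro allI impI conjI)
    fix c :: "nat \<Rightarrow> 'k" assume c: "ell2 c"
    show "(\<lambda>i. smul (c i) (weaving \<sigma> \<phi> \<psi> i)) summable_on UNIV"
      using *[OF c] by (rule has_sum_imp_summable)
    let ?c1 = "\<lambda>i. if i \<in> \<sigma> then c i else 0" and ?c2 = "\<lambda>i. if i \<in> \<sigma> then 0 else c i"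
    have c12: "ell2 ?c1" "l2norm ?c1 \<le> l2norm c" "ell2 ?c2" "l2norm ?c2 \<le> l2norm c"
      by (rule ell2_mono[OF c]; simp)+
    have "norm (synth (weaving \<sigma> \<phi> \<psi>) c) \<le> norm (synth \<phi> ?c1) + norm (synth \<psi> ?c2)"
      unfolding eq[OF c] by (rule norm_triangle_ineq)
    also have "\<dots> \<le> B * l2norm ?c1 + B' * l2norm ?c2"
      by (intro add_mono norm_synth_le[OF \<phi>] norm_synth_le[OF \<psi>] c12)
    also have "\<dots> \<le> B * l2norm c + B' * l2norm c"
      by (intro add_mono mult_left_mono c12 B)
    finally show "norm (synth (weaving \<sigma> \<phi> \<psi>) c) \<le> (B + B') * l2norm c"
      by (simp add: distrib_right)
  qed
qed

locale weaving_pair = hilbert_space smul ip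
  for smul :: "'k::rc_field \<Rightarrow> 'h::banach \<Rightarrow> 'h" and ip +
  fixes \<phi> \<psi> :: "nat \<Rightarrow> 'h" and a B :: real
  assumes a_pos: "0 < a" and B_pos: "0 < B"
    and bessel_phi: "bessel \<phi> B" and bessel_psi: "bessel \<psi> B"
    and below_phi: "bounded_below \<phi> a" and below_psi: "bounded_below \<psi> a"
    and onto_phi: "onto \<phi>"
begin

abbreviation weave :: "nat set \<Rightarrow> nat \<Rightarrow> 'h" where
  "weave \<sigma> \<equiv> weaving \<sigma> \<phi> \<psi>"

lemma bessel_weave: "bessel (weave \<sigma>) (2 * B)"
  unfolding mult_2 by (intro bessel_weaving(2) bessel_phi bessel_psi less_imp_le[OF B_pos])

text \<open>Weavings over sets that agree below \<open>N\<close> treat the first \<open>N\<close> coefficients alike, so only the tail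
  of \<open>c\<close> can tell them apart. This is strong continuity of synthesis in \<open>\<sigma>\<close>, uniform over the
  Cantor space.\<close>

lemma synth_agree:
  assumes "agree N \<sigma> \<tau>" "ell2 c"
  shows "norm (synth (weave \<sigma>) c - synth (weave \<tau>) c)
    \<le> 4 * B * l2norm (\<lambda>i. if i < N then 0 else c i)"
proof -
  let ?t = "\<lambda>i. if i < N then 0 else c i" and ?h = "\<lambda>i. if i < N then c i else 0"
  have t: "ell2 ?t" by (rule ell2_mono(1)[OF assms(2)]) simp
  have h: "ell2 ?h" by (rule ell2_mono(1)[OF assms(2)]) simp
  have c: "c = (\<lambda>i. ?h i + ?t i)" by auto
  have "synth (weave \<sigma>) ?h = synth (weave \<tau>) ?h"
  proof -
    have "synth (weave \<rho>) ?h = (\<Sum>i<N. smul (c i) (weave \<rho> i))" for \<rho>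
      by (subst synth_finite[of "{..<N}"]) auto
    moreover have "weave \<sigma> i = weave \<tau> i" if "i < N" for i
      using assms(1) that by (simp add: weaving_def agree_def)
    ultimately show ?thesis by simp
  qed
  then have "synth (weave \<sigma>) c - synth (weave \<tau>) c = synth (weave \<sigma>) ?t - synth (weave \<tau>) ?t"
    by (subst (1 2) c) (simp only: synth_add[OF bessel_weave h t] add_diff_cancel_left)
  also have "norm \<dots> \<le> 2 * B * l2norm ?t + 2 * B * l2norm ?t"
    by (rule order_trans[OF norm_triangle_ineq4 add_mono])
      (rule norm_synth_le[OF bessel_weave t])+
  finally show ?thesis by simp
qed

lemma synth_locally_uniform:
  assumes "ell2 c" "0 < e"
  obtains M where "K \<le> M"
    "\<And>\<sigma> \<tau>. agree M \<sigma> \<tau> \<Longrightarrow> norm (synth (weave \<sigma>) c - synth (weave \<tau>) c) < e"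
proof -
  have "(\<lambda>n. 4 * B * l2norm (\<lambda>i. if i < n then 0 else c i)) \<longlonglongrightarrow> 4 * B * 0"
    by (intro tendsto_mult_left l2norm_tail_tendsto_0 assms(1))
  then have "\<forall>\<^sub>F n in sequentially. 4 * B * l2norm (\<lambda>i. if i < n then 0 else c i) < e"
    using assms(2) by (simp add: order_tendsto_iff)
  then obtain M where "\<And>n. n \<ge> M \<Longrightarrow> 4 * B * l2norm (\<lambda>i. if i < n then 0 else c i) < e"
    unfolding eventually_sequentially by blast
  then have "norm (synth (weave \<sigma>) c - synth (weave \<tau>) c) < e" if "agree (max K M) \<sigma> \<tau>" for \<sigma> \<tau>
    using synth_agree[OF that assms(1)] by (meson max.cobounded2 order_le_less_trans)
  then show thesis using that[of "max K M"] by auto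
qed

text \<open>For cofinite \<open>\<sigma>\<close> the Fredholm alternative is reached by changing \<open>\<phi>\<close> into the weaving one vector at
  a time. The intermediate weavings must have the known property as well, which is why it is
  assumed for all sets.\<close>

lemma onto_cofinite:
  assumes "\<And>\<sigma>. injective (weave \<sigma>)" "finite (- \<sigma>)"
  shows "onto (weave \<sigma>)"
proof (rule finite_change_induct[of UNIV])
  show "finite {i. (i \<in> UNIV) \<noteq> (i \<in> \<sigma>)}" using assms(2) by (simp add: Compl_eq)
  show "onto (weave UNIV)" using onto_phi by (simp add: weaving_UNIV)
  show "onto (weave (flip j \<tau>))" if "onto (weave \<tau>)" for \<tau> j
    by (rule change_one_onto[OF bessel_weave weaving_flip[symmetric] that assms(1)])
qed

lemma injective_cofinite:
  assumes "\<And>\<sigma>. onto (weave \<sigma>)" "finite (- \<sigma>)"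
  shows "injective (weave \<sigma>)"
proof (rule finite_change_induct[of UNIV])
  show "finite {i. (i \<in> UNIV) \<noteq> (i \<in> \<sigma>)}" using assms(2) by (simp add: Compl_eq)
  show "injective (weave UNIV)"
    using bounded_below_injective[OF below_phi a_pos] by (simp add: weaving_UNIV)
  show "injective (weave (flip j \<tau>))" if "injective (weave \<tau>)" for \<tau> j
    by (rule change_one_injective[OF bessel_weave bessel_weave weaving_flip[symmetric]
          assms(1) that assms(1)])
qed

lemma bounded_below_limit:
  assumes "\<And>n. bounded_below (weave (\<sigma> \<union> {n..})) b"
  shows "bounded_below (weave \<sigma>) b"
  unfolding bounded_below_def
proof (intro allI impI)
  fix c :: "nat \<Rightarrow> 'k" assume c: "ell2 c"
  show "b * l2norm c \<le> norm (synth (weave \<sigma>) c)"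
  proof (rule field_le_epsilon)
    fix e :: real assume "e > 0"
    obtain M where M: "\<And>\<sigma> \<tau>. agree M \<sigma> \<tau> \<Longrightarrow> norm (synth (weave \<sigma>) c - synth (weave \<tau>) c) < e"
      using synth_locally_uniform[OF c \<open>e > 0\<close>] by metis
    have "agree M (\<sigma> \<union> {M..}) \<sigma>" by (auto simp: agree_def)
    from M[OF this] bounded_belowD[OF assms[of M] c]
      norm_triangle_ineq2[of "synth (weave (\<sigma> \<union> {M..})) c" "synth (weave \<sigma>) c"]
    show "b * l2norm c \<le> norm (synth (weave \<sigma>) c) + e" by linarith
  qed
qed

lemma frame_below_limit:
  assumes "\<And>n. n \<ge> N \<Longrightarrow> frame_below (weave (\<sigma> \<union> {n..})) b"
  shows "frame_below (weave \<sigma>) b"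
  unfolding frame_below_def
proof
  fix x
  define u where "u = (\<lambda>i. ip x (weave \<sigma> i))"
  define v where "v = (\<lambda>i. ip x (\<phi> i))"
  have u: "ell2 u" unfolding u_def by (rule ell2_analysis(1)[OF bessel_weave]) (use B_pos in simp)
  have v: "ell2 v" unfolding v_def by (rule ell2_analysis(1)[OF bessel_phi]) (use B_pos in simp)
  let ?t = "\<lambda>n i. if i < n then 0 else v i"
  have "b * norm x \<le> l2norm u + l2norm (?t n)" if "n \<ge> N" for n
  proof -
    let ?h = "\<lambda>i. if i < n then u i else 0"
    have h: "ell2 ?h" "l2norm ?h \<le> l2norm u" by (rule ell2_mono[OF u]; simp)+
    have t: "ell2 (?t n)" by (rule ell2_mono(1)[OF v]) simp
    have "b * norm x \<le> l2norm (\<lambda>i. ip x (weave (\<sigma> \<union> {n..}) i))"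
      using assms[OF that] unfolding frame_below_def by blast
    also have "(\<lambda>i. ip x (weave (\<sigma> \<union> {n..}) i)) = (\<lambda>i. ?h i + ?t n i)"
      by (auto simp: fun_eq_iff weaving_def u_def v_def)
    also have "l2norm \<dots> \<le> l2norm u + l2norm (?t n)"
      using ell2_add(2)[OF h(1) t] h(2) by linarith
    finally show ?thesis .
  qed
  then have ev: "\<forall>\<^sub>F n in sequentially. b * norm x \<le> l2norm u + l2norm (?t n)"
    unfolding eventually_sequentially by blast
  have "(\<lambda>n. l2norm u + l2norm (?t n)) \<longlonglongrightarrow> l2norm u + 0"
    by (intro tendsto_add tendsto_const l2norm_tail_tendsto_0 v)
  from tendsto_lowerbound[OF this ev] have "b * norm x \<le> l2norm u + 0" by simp
  then show "b * norm x \<le> l2norm (\<lambda>i. ip x (weave \<sigma> i))" by (simp add: u_def)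
qed

definition locally_bounded_below :: "nat set \<Rightarrow> bool" where
  "locally_bounded_below \<sigma> \<longleftrightarrow>
     (\<exists>b>0. \<exists>N. \<forall>\<tau>. agree N \<sigma> \<tau> \<longrightarrow> bounded_below (weave \<tau>) b)"

text \<open>The approximations \<open>\<sigma> \<union> {n..}\<close> of \<open>\<sigma>\<close> eventually lie in its neighbourhood and are cofinite, hence
  have bijective synthesis. There the lower bound transfers to the adjoint, and it
  survives the limit.\<close>

lemma frame_below_if_bounded_below:
  assumes inj: "\<And>\<sigma>. injective (weave \<sigma>)" and "0 < b"
    and b: "\<And>\<tau>. agree N \<sigma> \<tau> \<Longrightarrow> bounded_below (weave \<tau>) b"
  shows "frame_below (weave \<sigma>) b"
proof (rule frame_below_limit)
  fix n assume "n \<ge> N"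
  then have "bounded_below (weave (\<sigma> \<union> {n..})) b" by (intro b) (auto simp: agree_def)
  moreover have "onto (weave (\<sigma> \<union> {n..}))"
    by (rule onto_cofinite[OF inj]) (rule finite_subset[of _ "{..<n}"], auto)
  ultimately show "frame_below (weave (\<sigma> \<union> {n..})) b"
    using onto_bounded_below_frame_below[OF bessel_weave] B_pos \<open>0 < b\<close> by simp
qed

lemma onto_if_locally_bounded_below:
  assumes "\<And>\<sigma>. injective (weave \<sigma>)" "locally_bounded_below \<sigma>"
  shows "onto (weave \<sigma>)"
proof -
  obtain b N where "b > 0" "\<And>\<tau>. agree N \<sigma> \<tau> \<Longrightarrow> bounded_below (weave \<tau>) b"
    using assms(2) unfolding locally_bounded_below_def by blast
  then show ?thesis
    using frame_below_onto[OF bessel_weave _ frame_below_if_bounded_below[OF assms(1)]] B_pos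
    by fastforce
qed

text \<open>A quantitative form of the rank-one change that holds for all \<open>\<tau>\<close> near \<open>flip j \<sigma>\<close> at once. With
  \<open>c\<close> the preimage of the change \<open>y\<close> under \<open>W \<sigma>\<close>, and \<open>\<tau>' = flip j \<tau>\<close> near \<open>\<sigma>\<close>, strong continuity at the
  single vector \<open>c\<close> makes \<open>W \<tau>' c\<close> close to \<open>y\<close>, so that
  \<open>W \<tau>' (d - d j c)\<close> is \<open>W \<tau> d\<close> up to a small multiple of \<open>d j\<close>. The uniform bound near \<open>\<sigma>\<close> then
  controls \<open>d - d j c\<close>, whose \<open>j\<close>-th entry \<open>d j (1 - c j)\<close> in turn controls \<open>d j\<close>.\<close>

lemma locally_bounded_below_flip:
  assumes loc: "locally_bounded_below \<sigma>" and onto: "onto (weave \<sigma>)"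
    and inj: "injective (weave (flip j \<sigma>))"
  shows "locally_bounded_below (flip j \<sigma>)"
proof -
  define y where "y = weave \<sigma> j - weave (flip j \<sigma>) j"
  obtain c where c: "ell2 c" "synth (weave \<sigma>) c = y" using onto unfolding onto_def by blast
  have "c j \<noteq> 1"
    using change_one_coefficient[OF bessel_weave weaving_flip[symmetric] inj c(1)] c(2)
    by (simp add: y_def)
  define k where "k = norm (1 - c j)"
  have k: "k > 0" using \<open>c j \<noteq> 1\<close> by (simp add: k_def)
  obtain b N where b: "b > 0" "\<And>\<tau>. agree N \<sigma> \<tau> \<Longrightarrow> bounded_below (weave \<tau>) b"
    using loc unfolding locally_bounded_below_def by blast
  \<comment> \<open>Half of \<open>b * k\<close>, so that the error term in the estimate of \<open>r * (b * k)\<close> below can be absorbed.\<close>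
  define e where "e = b * k / 2"
  have "e > 0" using b(1) k by (simp add: e_def)
  \<comment> \<open>At least \<open>Suc j\<close>, so that all sets considered treat the index \<open>j\<close> like \<open>\<sigma>\<close> and \<open>flip j \<sigma>\<close> do.\<close>
  from synth_locally_uniform[OF c(1) this, of "max N (Suc j)"] obtain M
    where M: "max N (Suc j) \<le> M"
      "\<And>\<sigma> \<tau>. agree M \<sigma> \<tau> \<Longrightarrow> norm (synth (weave \<sigma>) c - synth (weave \<tau>) c) < e" by blast
  define K where "K = 2 / b + 2 / (b * k) * l2norm c"
  have K: "K > 0" using b(1) k by (simp add: K_def add_pos_nonneg)
  have "bounded_below (weave \<tau>) (1 / K)" if \<tau>: "agree M (flip j \<sigma>) \<tau>" for \<tau>
    unfolding bounded_below_def
  proof (intro allI impI)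
    fix d :: "nat \<Rightarrow> 'k" assume d: "ell2 d"
    define \<tau>' where "\<tau>' = flip j \<tau>"
    have ag: "agree M \<sigma> \<tau>'" unfolding \<tau>'_def by (rule agree_flip[OF \<tau>])
    have y: "weave \<tau>' j - weave \<tau> j = y"
      using ag \<tau> M(1) by (simp add: y_def weaving_def agree_def)
    define t where "t = norm (synth (weave \<tau>) d)"
    define r where "r = norm (d j)"
    let ?g = "\<lambda>i. d i - d j * c i"
    have g: "ell2 ?g" by (rule ell2_diff[OF d ell2_scale(1)[OF c(1)]])
    have "synth (weave \<tau>) d = synth (weave \<tau>') d - smul (d j) (weave \<tau>' j - weave \<tau> j)"
      unfolding \<tau>'_def by (rule synth_change_one[OF bessel_weave weaving_flip d])
    then have "synth (weave \<tau>') d = synth (weave \<tau>) d + smul (d j) y" by (simp add: y)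
    then have "synth (weave \<tau>') ?g
        = synth (weave \<tau>) d + smul (d j) (synth (weave \<sigma>) c - synth (weave \<tau>') c)"
      by (simp add: synth_diff[OF bessel_weave d ell2_scale(1)[OF c(1)]]
          synth_scale[OF bessel_weave c(1)] c(2) scale_right_diff_distrib)
    then have "norm (synth (weave \<tau>') ?g)
        \<le> t + norm (smul (d j) (synth (weave \<sigma>) c - synth (weave \<tau>') c))"
      unfolding t_def by (simp only: norm_triangle_ineq)
    also have "\<dots> \<le> t + r * e"
      unfolding norm_smul r_def
      by (intro add_left_mono mult_left_mono less_imp_le[OF M(2)[OF ag]] norm_ge_zero)
    finally have "norm (synth (weave \<tau>') ?g) \<le> t + r * e" .
    moreover have "bounded_below (weave \<tau>') b"
      using b(2) agree_mono[OF ag, of N] M(1) by simp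
    ultimately have G: "b * l2norm ?g \<le> t + r * e"
      using bounded_belowD[OF _ g] by (meson order_trans)
    have "r * k = norm (?g j)"
      by (simp add: r_def k_def norm_mult[symmetric] right_diff_distrib)
    then have "r * k \<le> l2norm ?g" using norm_le_l2norm[OF g, of j] by simp
    then have "b * (r * k) \<le> t + r * e"
      using G b(1) by (meson mult_left_mono less_imp_le order_trans)
    then have R: "r * (b * k) \<le> 2 * t" by (simp add: e_def algebra_simps)
    then have r: "r \<le> 2 / (b * k) * t" using b(1) k by (simp add: field_simps)
    have "b * l2norm ?g \<le> 2 * t" using G R by (simp add: e_def algebra_simps)
    then have g': "l2norm ?g \<le> 2 / b * t" using b(1) by (simp add: field_simps)
    have "l2norm d = l2norm (\<lambda>i. ?g i + d j * c i)" by simp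
    also have "\<dots> \<le> l2norm ?g + r * l2norm c"
      using ell2_add(2)[OF g ell2_scale(1)[OF c(1)], of "d j"] ell2_scale(2)[OF c(1), of "d j"]
      by (simp add: r_def)
    also have "\<dots> \<le> 2 / b * t + 2 / (b * k) * t * l2norm c"
      using g' mult_right_mono[OF r l2norm_nonneg[of c]] by (rule add_mono)
    also have "\<dots> = K * t" by (simp add: K_def algebra_simps)
    finally show "1 / K * l2norm d \<le> norm (synth (weave \<tau>) d)"
      using K by (simp add: t_def field_simps)
  qed
  then show ?thesis
    unfolding locally_bounded_below_def using K by (intro exI[of _ "1 / K"]) auto
qed

text \<open>The Baire category theorem for the closed sets of those \<open>\<sigma>\<close> whose synthesis is bounded below by
  \<open>1 / Suc n\<close>, carried out by hand: if no cylinder has a uniform bound, every cylinder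
  contains a smaller one on which a single vector \<open>c\<close> refutes the \<open>n\<close>-th bound, and the limit point of a
  nested sequence of such cylinders has no lower bound at all.\<close>

lemma some_locally_bounded_below:
  assumes "\<And>\<sigma>. \<exists>b>0. bounded_below (weave \<sigma>) b"
  obtains \<sigma> where "locally_bounded_below \<sigma>"
proof (rule ccontr)
  assume "\<not> thesis"
  with that have not_loc: "\<not> locally_bounded_below \<sigma>" for \<sigma> by blast
  have step: "\<exists>\<tau> M c. agree N \<sigma> \<tau> \<and> N < M \<and> ell2 c \<and>
      (\<forall>\<rho>. agree M \<tau> \<rho> \<longrightarrow> norm (synth (weave \<rho>) c) < l2norm c / real (Suc n))" for N \<sigma> n
  proof -
    define b where "b = 1 / (2 * real (Suc n))"
    have "b > 0" by (simp add: b_def)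
    with not_loc[of \<sigma>] obtain \<tau> where \<tau>: "agree N \<sigma> \<tau>" "\<not> bounded_below (weave \<tau>) b"
      unfolding locally_bounded_below_def by blast
    then obtain c where c: "ell2 c" "norm (synth (weave \<tau>) c) < b * l2norm c"
      unfolding bounded_below_def by (auto simp: not_le)
    then have "b * l2norm c > 0" using norm_ge_zero order_le_less_trans by blast
    from synth_locally_uniform[OF c(1) this, of "Suc N"] obtain M where M: "Suc N \<le> M"
      "\<And>\<sigma> \<rho>. agree M \<sigma> \<rho> \<Longrightarrow> norm (synth (weave \<sigma>) c - synth (weave \<rho>) c) < b * l2norm c"
      by blast
    have "norm (synth (weave \<rho>) c) < l2norm c / real (Suc n)" if "agree M \<tau> \<rho>" for \<rho>
    proof -
      have "norm (synth (weave \<rho>) c) < 2 * (b * l2norm c)"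
        using M(2)[OF that] c(2) norm_triangle_ineq2[of "synth (weave \<rho>) c" "synth (weave \<tau>) c"]
        by (simp add: norm_minus_commute)
      also have "2 * (b * l2norm c) = l2norm c / real (Suc n)" by (simp add: b_def field_simps)
      finally show ?thesis .
    qed
    with \<tau>(1) M(1) c(1) show ?thesis by (meson Suc_le_lessD)
  qed
  define Q where "Q = (\<lambda>n p q. agree (snd p) (fst p) (fst q) \<and> snd p < (snd q :: nat) \<and>
      (\<exists>c. ell2 c \<and> (\<forall>\<rho>. agree (snd q) (fst q) \<rho> \<longrightarrow>
        norm (synth (weave \<rho>) c) < l2norm c / real (Suc n))))"
  have "\<exists>q. True \<and> Q n p q" for n p
    using step[of "snd p" "fst p" n] unfolding Q_def by auto
  from dependent_nat_choice[of "\<lambda>_ _. True" Q, OF _ this] obtain f where f: "\<And>n. Q n (f n) (f (Suc n))"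
    by auto
  obtain \<sigma> where \<sigma>: "\<And>n. agree (snd (f n)) (fst (f n)) \<sigma>"
    by (rule nested_cylinders_limit[of "\<lambda>n. snd (f n)" "\<lambda>n. fst (f n)"])
      (use f in \<open>auto simp: Q_def\<close>)
  obtain b where b: "b > 0" "bounded_below (weave \<sigma>) b" using assms by blast
  obtain n where n: "1 / real (Suc n) < b"
    using reals_Archimedean[OF b(1)] by (auto simp: inverse_eq_divide)
  obtain c where c: "ell2 c" "norm (synth (weave \<sigma>) c) < l2norm c / real (Suc n)"
    using f[of n] \<sigma>[of "Suc n"] unfolding Q_def by blast
  have "l2norm c / real (Suc n) \<le> b * l2norm c"
    using mult_right_mono[OF less_imp_le[OF n] l2norm_nonneg[of c]] by simp
  with bounded_belowD[OF b(2) c(1)] c(2) show False by linarith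
qed

text \<open>Compactness of the Cantor space in the form of Koenig's lemma: a cylinder without uniform bound
  has a half without uniform bound, and the limit of successive halves has no good
  neighbourhood.\<close>

lemma uniform_if_locally_bounded_below:
  assumes "\<And>\<sigma>. locally_bounded_below \<sigma>"
  obtains b where "b > 0" "\<And>\<sigma>. bounded_below (weave \<sigma>) b"
proof -
  define U where "U = (\<lambda>N \<sigma>. \<exists>b>0. \<forall>\<tau>. agree N \<sigma> \<tau> \<longrightarrow> bounded_below (weave \<tau>) b)"
  have mono: "bounded_below w b" if "bounded_below w b'" "b \<le> b'" for b b' and w :: "nat \<Rightarrow> 'h"
    using that mult_right_mono[OF that(2) l2norm_nonneg] unfolding bounded_below_def
    by (meson order_trans)
  have step: "\<exists>\<sigma>'. \<not> U (Suc N) \<sigma>' \<and> agree N \<sigma> \<sigma>'" if "\<not> U N \<sigma>" for N \<sigma>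
  proof (rule ccontr)
    assume *: "\<not> ?thesis"
    have "agree N \<sigma> (insert N \<sigma>)" "agree N \<sigma> (\<sigma> - {N})" by (auto simp: agree_def)
    with * have "U (Suc N) (insert N \<sigma>)" "U (Suc N) (\<sigma> - {N})" by blast+
    then obtain b1 b2 where b: "b1 > 0" "b2 > 0"
      "\<And>\<tau>. agree (Suc N) (insert N \<sigma>) \<tau> \<Longrightarrow> bounded_below (weave \<tau>) b1"
      "\<And>\<tau>. agree (Suc N) (\<sigma> - {N}) \<tau> \<Longrightarrow> bounded_below (weave \<tau>) b2"
      unfolding U_def by blast
    have "bounded_below (weave \<tau>) (min b1 b2)" if "agree N \<sigma> \<tau>" for \<tau>
    proof (cases "N \<in> \<tau>")
      case True
      with that have "agree (Suc N) (insert N \<sigma>) \<tau>" by (auto simp: agree_def less_Suc_eq)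
      from mono[OF b(3)[OF this]] show ?thesis by simp
    next
      case False
      with that have "agree (Suc N) (\<sigma> - {N}) \<tau>" by (auto simp: agree_def less_Suc_eq)
      from mono[OF b(4)[OF this]] show ?thesis by simp
    qed
    then have "U N \<sigma>" unfolding U_def using b(1,2) by (intro exI[of _ "min b1 b2"]) auto
    with that show False by blast
  qed
  have "U 0 UNIV"
  proof (rule ccontr)
    assume "\<not> U 0 UNIV"
    with step obtain f where f: "\<And>n. \<not> U n (f n)" "\<And>n. agree n (f n) (f (Suc n))"
      using dependent_nat_choice[of "\<lambda>n \<sigma>. \<not> U n \<sigma>" "\<lambda>n \<sigma> \<sigma>'. agree n \<sigma> \<sigma>'"] by blast
    obtain \<sigma> where \<sigma>: "\<And>n. agree n (f n) \<sigma>"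
      using nested_cylinders_limit[of "\<lambda>n. n" f] f(2) by auto
    obtain b N where "b > 0" "\<And>\<tau>. agree N \<sigma> \<tau> \<Longrightarrow> bounded_below (weave \<tau>) b"
      using assms[of \<sigma>] unfolding locally_bounded_below_def by blast
    moreover have "agree N \<sigma> \<tau>" if "agree N (f N) \<tau>" for \<tau>
      using \<sigma>[of N] that by (auto simp: agree_def)
    ultimately have "U N (f N)" unfolding U_def by blast
    with f(1) show False by blast
  qed
  then show thesis using that unfolding U_def agree_def by auto
qed

lemma uniformly_bounded_below:
  assumes below: "\<And>\<sigma>. \<exists>b>0. bounded_below (weave \<sigma>) b"
  obtains b where "b > 0" "\<And>\<sigma>. bounded_below (weave \<sigma>) b"
proof -
  have inj: "injective (weave \<sigma>)" for \<sigma>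
    using below[of \<sigma>] bounded_below_injective by blast
  obtain \<rho> where "locally_bounded_below \<rho>" using some_locally_bounded_below[OF below] .
  then obtain b N where b: "b > 0" "\<And>\<tau>. agree N \<rho> \<tau> \<Longrightarrow> bounded_below (weave \<tau>) b"
    unfolding locally_bounded_below_def by blast
  \<comment> \<open>Start from the set that follows \<open>\<rho>\<close> below \<open>N\<close> and \<open>\<sigma>\<close> from there on.\<close>
  have "locally_bounded_below \<sigma>" for \<sigma>
  proof (rule finite_change_induct)
    let ?\<rho> = "(\<rho> \<inter> {..<N}) \<union> (\<sigma> \<inter> {N..})"
    show "finite {i. (i \<in> ?\<rho>) \<noteq> (i \<in> \<sigma>)}"
      by (rule finite_subset[of _ "{..<N}"]) auto
    have "agree N \<rho> \<tau>" if "agree N ?\<rho> \<tau>" for \<tau>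
      using that by (auto simp: agree_def)
    with b show "locally_bounded_below ?\<rho>" unfolding locally_bounded_below_def by blast
    show "locally_bounded_below (flip j \<tau>)" if "locally_bounded_below \<tau>" for \<tau> j
      using that onto_if_locally_bounded_below[OF inj that] inj by (rule locally_bounded_below_flip)
  qed
  from uniform_if_locally_bounded_below[OF this] that show thesis by blast
qed

end
section \<open>Distances between the spans\<close>

text \<open>Scaling removes the unit vectors from the definition of the distance. The form without them is
  homogeneous, includes the case of a trivial subspace, and passes to closures.\<close>

lemma subspace_dist_ge_iff:
  fixes V W :: "'h::real_normed_vector set"
  assumes V: "\<And>r x. x \<in> V \<Longrightarrow> r *\<^sub>R x \<in> V" and W: "\<And>r x. x \<in> W \<Longrightarrow> r *\<^sub>R x \<in> W"
  shows "ereal C \<le> subspace_dist V W \<longleftrightarrow>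
    (\<forall>x\<in>V. \<forall>y\<in>W. C * norm x \<le> norm (x - y) \<and> C * norm y \<le> norm (x - y))"
    (is "?L \<longleftrightarrow> ?R")
proof
  assume ?L
  then have L: "ereal C \<le> gap_left V W" "ereal C \<le> gap_right V W"
    by (simp_all add: subspace_dist_def)
  have unit: "C \<le> norm (x - y)" if xy: "x \<in> V" "y \<in> W" "norm x = 1 \<or> norm y = 1" for x y
    using xy(3)
  proof
    assume "norm x = 1"
    then have "gap_right V W \<le> ereal (norm (x - y))"
      unfolding gap_right_def unit_vectors_def using xy by (intro Inf_lower) blast
    with L(2) have "ereal C \<le> ereal (norm (x - y))" by (rule order_trans)
    then show ?thesis by simp
  next
    assume "norm y = 1"
    then have "gap_left V W \<le> ereal (norm (x - y))"
      unfolding gap_left_def unit_vectors_def using xy by (intro Inf_lower) blast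
    with L(1) have "ereal C \<le> ereal (norm (x - y))" by (rule order_trans)
    then show ?thesis by simp
  qed
  show ?R
  proof (intro ballI conjI)
    fix x y assume xy: "x \<in> V" "y \<in> W"
    have scaled: "C * norm z \<le> norm (x - y)" if "z = x \<or> z = y" for z
    proof (cases "z = 0")
      case False
      let ?r = "1 / norm z"
      have "C \<le> norm (?r *\<^sub>R x - ?r *\<^sub>R y)"
        by (rule unit) (use V[OF xy(1)] W[OF xy(2)] that False in auto)
      also have "\<dots> = norm (x - y) / norm z"
        unfolding scaleR_diff_right[symmetric] by simp
      finally show ?thesis using False by (simp add: field_simps)
    qed simp
    show "C * norm x \<le> norm (x - y)" "C * norm y \<le> norm (x - y)"
      by (rule scaled; simp)+
  qed
next
  assume R: ?R
  show ?L
    unfolding subspace_dist_def gap_left_def gap_right_def unit_vectors_def min.bounded_iff le_Inf_iff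
  proof safe
    fix x y assume "x \<in> V" "y \<in> W" "norm y = 1"
    with R show "ereal C \<le> ereal (norm (x - y))" by fastforce
  next
    fix x y assume "x \<in> V" "y \<in> W" "norm x = 1"
    with R show "ereal C \<le> ereal (norm (x - y))" by fastforce
  qed
qed

lemma (in hilbert_space) weaving_dist_ge_iff:
  "ereal C \<le> weaving_dist smul \<phi> \<psi> \<sigma> \<longleftrightarrow>
    (\<forall>x\<in>closed_span smul (\<phi> ` \<sigma>). \<forall>y\<in>closed_span smul (\<psi> ` (- \<sigma>)).
      C * norm x \<le> norm (x - y) \<and> C * norm y \<le> norm (x - y))"
  unfolding weaving_dist_def by (rule subspace_dist_ge_iff) (erule closed_span_scaleR)+

context weaving_pair
begin

text \<open>For vectors \<open>x = synth \<phi> c\<close> and \<open>y = synth \<psi> d\<close> of the two spans, \<open>x - y\<close> is the weaving synthesis of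
  \<open>c - d\<close>. The coefficients have disjoint supports, so there is no cancellation and
  \<open>\<parallel>c - d\<parallel>\<close> dominates \<open>\<parallel>c\<parallel> \<ge> \<parallel>x\<parallel> / B\<close> and \<open>\<parallel>d\<parallel> \<ge> \<parallel>y\<parallel> / B\<close>.\<close>

lemma bounded_below_weaving_dist:
  assumes b: "bounded_below (weave \<sigma>) b" "0 \<le> b"
  shows "ereal (b / B) \<le> weaving_dist smul \<phi> \<psi> \<sigma>"
proof -
  let ?C = "b / B"
  let ?S = "span (\<phi> ` \<sigma>)" and ?T = "span (\<psi> ` (- \<sigma>))"
  have spans: "?C * norm x \<le> norm (x - y) \<and> ?C * norm y \<le> norm (x - y)"
    if xy: "x \<in> ?S" "y \<in> ?T" for x y
  proof -
    obtain c where c: "ell2 c" "\<And>i. i \<notin> \<sigma> \<Longrightarrow> c i = 0" "synth \<phi> c = x"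
      using span_image_synth[OF bessel_phi xy(1)] by metis
    obtain d where d: "ell2 d" "\<And>i. i \<notin> - \<sigma> \<Longrightarrow> d i = 0" "synth \<psi> d = y"
      using span_image_synth[OF bessel_psi xy(2)] by metis
    have cd: "ell2 (\<lambda>i. c i - d i)" by (rule ell2_diff[OF c(1) d(1)])
    have "(\<lambda>i. if i \<in> \<sigma> then c i - d i else 0) = c"
      "(\<lambda>i. if i \<in> \<sigma> then 0 else c i - d i) = (\<lambda>i. 0 - d i)"
      using c(2) d(2) by (auto simp: fun_eq_iff)
    then have "synth (weave \<sigma>) (\<lambda>i. c i - d i) = x - y"
      using bessel_weaving(1)[OF bessel_phi bessel_psi _ _ cd, of \<sigma>] B_pos
        synth_diff[OF bessel_psi ell2_zero(1) d(1)] c(3) d(3) by simp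
    then have low: "b * l2norm (\<lambda>i. c i - d i) \<le> norm (x - y)"
      using bounded_belowD[OF b(1) cd] by simp
    have "norm (c i) \<le> norm (c i - d i)" "norm (d i) \<le> norm (c i - d i)" for i
      using c(2)[of i] d(2)[of i] by (cases "i \<in> \<sigma>"; simp)+
    then have "l2norm c \<le> l2norm (\<lambda>i. c i - d i)" "l2norm d \<le> l2norm (\<lambda>i. c i - d i)"
      by (blast intro: ell2_mono(2)[OF cd])+
    then have le: "b * l2norm c \<le> norm (x - y)" "b * l2norm d \<le> norm (x - y)"
      using low mult_left_mono[OF _ b(2)] by (meson order_trans)+
    have "?C * norm x \<le> ?C * (B * l2norm c)" "?C * norm y \<le> ?C * (B * l2norm d)"
      using norm_synth_le[OF bessel_phi c(1)] norm_synth_le[OF bessel_psi d(1)] b(2) B_pos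
      unfolding c(3) d(3) by (intro mult_left_mono; simp)+
    with le B_pos show ?thesis by simp
  qed
  have "?C * norm x \<le> norm (x - y) \<and> ?C * norm y \<le> norm (x - y)"
    if xy: "x \<in> closure ?S" "y \<in> closure ?T" for x y
  proof -
    obtain s t where s: "\<And>n. s n \<in> ?S" "s \<longlonglongrightarrow> x" and t: "\<And>n. t n \<in> ?T" "t \<longlonglongrightarrow> y"
      using xy by (auto simp: closure_sequential)
    have "(\<lambda>n. norm (s n - t n)) \<longlonglongrightarrow> norm (x - y)" by (intro tendsto_intros s t)
    moreover have "(\<lambda>n. ?C * norm (s n)) \<longlonglongrightarrow> ?C * norm x" by (intro tendsto_intros s)
    moreover have "(\<lambda>n. ?C * norm (t n)) \<longlonglongrightarrow> ?C * norm y" by (intro tendsto_intros t)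
    ultimately show ?thesis using spans[OF s(1) t(1)] by (meson LIMSEQ_le)
  qed
  then show ?thesis
    unfolding weaving_dist_ge_iff by (simp add: closed_span_def)
qed

text \<open>Conversely the two parts of \<open>W \<sigma> c\<close> are each controlled by their distance to the other
  span, and the Riesz bounds of \<open>\<phi>\<close> and \<open>\<psi>\<close> recover the coefficients from the parts.\<close>

lemma weaving_dist_bounded_below:
  assumes C: "ereal C \<le> weaving_dist smul \<phi> \<psi> \<sigma>" "C > 0"
  shows "bounded_below (weave \<sigma>) (C * a / 2)"
  unfolding bounded_below_def
proof (intro allI impI)
  fix c :: "nat \<Rightarrow> 'k" assume c: "ell2 c"
  let ?c = "\<lambda>i. if i \<in> \<sigma> then c i else 0" and ?d = "\<lambda>i. if i \<in> \<sigma> then 0 else c i"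
  let ?d' = "\<lambda>i. 0 - ?d i"
  have cd: "ell2 ?c" "ell2 ?d" by (rule ell2_mono(1)[OF c]; simp)+
  have d': "ell2 ?d'" by (rule ell2_diff[OF ell2_zero(1) cd(2)])
  define t where "t = norm (synth (weave \<sigma>) c)"
  have "synth \<psi> ?d' = - synth \<psi> ?d"
    using synth_diff[OF bessel_psi ell2_zero(1) cd(2)] by simp
  then have t: "t = norm (synth \<phi> ?c - synth \<psi> ?d')"
    using bessel_weaving(1)[OF bessel_phi bessel_psi _ _ c, of \<sigma>] B_pos by (simp add: t_def)
  have in_\<phi>: "synth \<phi> ?c \<in> closed_span smul (\<phi> ` \<sigma>)"
    by (rule synth_in_closed_span[OF bessel_phi cd(1)]) simp
  have in_\<psi>: "synth \<psi> ?d' \<in> closed_span smul (\<psi> ` (- \<sigma>))"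
    by (rule synth_in_closed_span[OF bessel_psi d']) simp
  note gap = C(1)[unfolded weaving_dist_ge_iff]
  have dist: "C * norm (synth \<phi> ?c) \<le> t" "C * norm (synth \<psi> ?d') \<le> t"
    using gap[rule_format, OF in_\<phi> in_\<psi>] by (simp_all only: t)
  have "l2norm ?d' = l2norm ?d" by (simp add: l2norm_def)
  then have "a * l2norm ?c \<le> norm (synth \<phi> ?c)" "a * l2norm ?d \<le> norm (synth \<psi> ?d')"
    using bounded_belowD[OF below_phi cd(1)] bounded_belowD[OF below_psi d'] by simp_all
  then have "C * (a * l2norm ?c) \<le> t" "C * (a * l2norm ?d) \<le> t"
    using dist C(2) by (meson mult_left_mono less_imp_le order_trans)+
  then have "C * a * (l2norm ?c + l2norm ?d) \<le> 2 * t" by (simp add: algebra_simps)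
  moreover have "(\<lambda>i. ?c i + ?d i) = c" by auto
  then have "l2norm c \<le> l2norm ?c + l2norm ?d" using ell2_add(2)[OF cd] by simp
  then have "C * a * l2norm c \<le> C * a * (l2norm ?c + l2norm ?d)"
    using C(2) a_pos by (intro mult_left_mono) simp_all
  ultimately have "C * a * l2norm c \<le> 2 * t" by linarith
  then show "C * a / 2 * l2norm c \<le> norm (synth (weave \<sigma>) c)" by (simp add: t_def)
qed

text \<open>In both directions the equivalence of injectivity and surjectivity on cofinite sets converts a
  uniform bound for one map into a uniform bound for its adjoint, and the limit over
  \<open>\<sigma> \<union> {n..}\<close> extends it to all sets.\<close>

lemma woven_iff_uniformly_bounded_below:
  "woven ip \<phi> \<psi> \<longleftrightarrow> (\<exists>b>0. \<forall>\<sigma>. bounded_below (weave \<sigma>) b)"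
proof
  assume "woven ip \<phi> \<psi>"
  then obtain A A' where A: "0 < A" "\<And>\<sigma>. frame_bounds ip UNIV (weave \<sigma>) A A'"
    unfolding woven_def by blast
  have B2: "0 < 2 * B" and sA: "0 < sqrt A" using B_pos A(1) by simp_all
  note fr = frame_bounds_frame_below[OF A(2)]
  have onto: "onto (weave \<sigma>)" for \<sigma> by (rule frame_below_onto[OF bessel_weave B2 fr sA])
  have "bounded_below (weave \<sigma>) (sqrt A)" for \<sigma>
  proof (rule bounded_below_limit)
    fix n
    have "injective (weave (\<sigma> \<union> {n..}))"
      by (rule injective_cofinite[OF onto]) (rule finite_subset[of _ "{..<n}"], auto)
    then show "bounded_below (weave (\<sigma> \<union> {n..})) (sqrt A)"
      by (rule frame_below_injective_bounded_below[OF bessel_weave B2 fr sA])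
  qed
  with sA show "\<exists>b>0. \<forall>\<sigma>. bounded_below (weave \<sigma>) b" by blast
next
  assume "\<exists>b>0. \<forall>\<sigma>. bounded_below (weave \<sigma>) b"
  then obtain b where b: "b > 0" "\<And>\<sigma>. bounded_below (weave \<sigma>) b" by blast
  have inj: "injective (weave \<sigma>)" for \<sigma> by (rule bounded_below_injective[OF b(2,1)])
  have frame: "frame_bounds ip UNIV (weave \<sigma>) (b\<^sup>2) ((b + 2 * B)\<^sup>2)" for \<sigma>
    by (rule frame_boundsI[OF bessel_weave _ frame_below_if_bounded_below[OF inj b(1) b(2)] b(1)])
      (use B_pos in simp)
  have "is_frame ip UNIV \<phi>" "is_frame ip UNIV \<psi>"
    using frame[of UNIV] frame[of "{}"] unfolding is_frame_def weaving_UNIV weaving_empty by blast+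
  moreover have "0 < b\<^sup>2" "b\<^sup>2 \<le> (b + 2 * B)\<^sup>2" using b(1) B_pos by (auto intro: power_mono)
  ultimately show "woven ip \<phi> \<psi>" using frame unfolding woven_def by blast
qed

end

section \<open>The characterisation\<close>

theorem theorem5p7:
  fixes smul :: "'k::rc_field \<Rightarrow> 'h::banach \<Rightarrow> 'h"
    and ip :: "'h \<Rightarrow> 'h \<Rightarrow> 'k"
    and \<phi> \<psi> :: "nat \<Rightarrow> 'h"
  assumes "hilbert_space smul ip"
    and "riesz_basis smul UNIV \<phi>"
    and "riesz_basis smul UNIV \<psi>"
  shows "(woven ip \<phi> \<psi> \<longleftrightarrow> (\<forall>\<sigma>. weaving_dist smul \<phi> \<psi> \<sigma> > 0)) \<and>
         ((\<forall>\<sigma>. weaving_dist smul \<phi> \<psi> \<sigma> > 0) \<longleftrightarrow>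
          (\<exists>C>0. \<forall>\<sigma>. weaving_dist smul \<phi> \<psi> \<sigma> \<ge> ereal C))"
proof -
  interpret hilbert_space smul ip by fact
  obtain A1 B1 A2 B2 where r: "riesz_bounds smul UNIV \<phi> A1 B1" "riesz_bounds smul UNIV \<psi> A2 B2"
    using assms(2,3) unfolding riesz_basis_def riesz_sequence_def by blast
  have pos: "0 < A1" "0 < B1" "0 < A2" "0 < B2" using r unfolding riesz_bounds_def by auto
  define a where "a = min (sqrt A1) (sqrt A2)"
  define B where "B = max (sqrt B1) (sqrt B2)"
  have a_pos: "0 < a" and B_pos: "0 < B" using pos by (auto simp: a_def B_def less_max_iff_disj)
  have bes: "bessel w B" if "bessel w B'" "B' \<le> B" for w :: "nat \<Rightarrow> 'h" and B'
    using that mult_right_mono[OF that(2) l2norm_nonneg] unfolding bessel_def by (meson order_trans)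
  have bel: "bounded_below w a" if "bounded_below w a'" "a \<le> a'" for w :: "nat \<Rightarrow> 'h" and a'
    using that mult_right_mono[OF that(2) l2norm_nonneg] unfolding bounded_below_def
    by (meson order_trans)
  have bessel: "bessel \<phi> B" "bessel \<psi> B"
    by (rule bes[OF riesz_bounds_bounded(1)[OF r(1)]] bes[OF riesz_bounds_bounded(1)[OF r(2)]];
        simp add: B_def)+
  have below: "bounded_below \<phi> a" "bounded_below \<psi> a"
    by (rule bel[OF riesz_bounds_bounded(2)[OF r(1)]] bel[OF riesz_bounds_bounded(2)[OF r(2)]];
        simp add: a_def)+
  have "onto \<phi>"
    by (rule bounded_below_dense_onto[OF bessel(1) below(1) a_pos])
      (use assms(2) in \<open>simp add: riesz_basis_def\<close>)
  then interpret weaving_pair smul ip \<phi> \<psi> a B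
    using a_pos B_pos bessel below by unfold_locales
  let ?i = "woven ip \<phi> \<psi>" and ?ii = "\<forall>\<sigma>. weaving_dist smul \<phi> \<psi> \<sigma> > 0"
    and ?iii = "\<exists>C>0. \<forall>\<sigma>. weaving_dist smul \<phi> \<psi> \<sigma> \<ge> ereal C"
    and ?u = "\<exists>b>0. \<forall>\<sigma>. bounded_below (weave \<sigma>) b"
  have "?u \<Longrightarrow> ?iii"
    using bounded_below_weaving_dist B_pos by (meson divide_pos_pos less_imp_le)
  moreover have "?iii \<Longrightarrow> ?ii"
    by (meson ereal_less(2) less_le_trans)
  moreover have "?u" if ii: ?ii
  proof -
    have "\<exists>b>0. bounded_below (weave \<sigma>) b" for \<sigma>
    proof -
      obtain C where "0 < ereal C" "ereal C < weaving_dist smul \<phi> \<psi> \<sigma>"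
        using ereal_dense2 ii by meson
      then have "bounded_below (weave \<sigma>) (C * a / 2)" "C * a / 2 > 0"
        using weaving_dist_bounded_below[of C \<sigma>] a_pos by auto
      then show ?thesis by blast
    qed
    from uniformly_bounded_below[OF this] show ?u by metis
  qed
  ultimately show ?thesis
    using woven_iff_uniformly_bounded_below by blast
qed

end
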